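(* Let five pairwise distinct generalized circles be given in the plane (completed by the point $\infty$), not all of which are tangent at one and the same point. Then there exist at most $4$ generalized circles that are tangent to each of the five given ones.
   Context: The plane is completed by one point at infinity $\infty$, through which every line passes. A generalized circle is a circle, a line (together with $\infty$), or a point (the point $\infty$ is allowed). Two generalized circles are called tangent (in the generalized sense) if one of the following holds: (1) they are two tangent circles, or a circle and a line tangent to it; (2) they are two (distinct) parallel lines (tangent at $\infty$); (3) one is a point and the other is a circle or line containing this point (tangent at that point). Generalized circles are "all tangent at one point" if there is a point $P$ (possibly $\infty$) such that any two of them are tangent at $P$. *)

theory Defs
  imports "HOL-Analysis.Analysis"
begin

text \<open>
  The Euclidean plane is \<^typ>\<open>complex\<close>. The completed plane is \<^typ>\<open>complex option\<close>,
  where \<^term>\<open>None\<close> is the point at infinity (as in the library's Alexandroff compactification).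
  Generalized circles are sets of points of the completed plane, so that being distinct
  means being different as sets.
\<close>

type_synonym ext_plane = "complex option"

definition straight_line :: "complex set \<Rightarrow> bool" where
  "straight_line L \<longleftrightarrow> affine L \<and> aff_dim L = 1"

definition is_circle :: "ext_plane set \<Rightarrow> bool" where
  "is_circle C \<longleftrightarrow> (\<exists>c r. r > 0 \<and> C = Some ` sphere c r)"

definition ext_line :: "complex set \<Rightarrow> ext_plane set" where
  "ext_line L = insert None (Some ` L)"

definition is_line :: "ext_plane set \<Rightarrow> bool" where
  "is_line C \<longleftrightarrow> (\<exists>L. straight_line L \<and> C = ext_line L)"

definition is_point :: "ext_plane set \<Rightarrow> bool" where
  "is_point C \<longleftrightarrow> (\<exists>P. C = {P})"

definition gen_circle :: "ext_plane set \<Rightarrow> bool" where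
  "gen_circle C \<longleftrightarrow> is_circle C \<or> is_line C \<or> is_point C"

text \<open>
  Two circles, or a circle and a line, are tangent at \<open>P\<close> if \<open>P\<close> is their only common point
  (internal and external tangency of circles are both allowed; no circle is tangent to itself).
  A generalized circle consisting of one point is never tangent to another such one.
\<close>

inductive tangent_at :: "ext_plane \<Rightarrow> ext_plane set \<Rightarrow> ext_plane set \<Rightarrow> bool" where
  circle_circle: "is_circle C \<Longrightarrow> is_circle D \<Longrightarrow> C \<inter> D = {P} \<Longrightarrow> tangent_at P C D"
| circle_line: "is_circle C \<Longrightarrow> is_line D \<Longrightarrow> C \<inter> D = {P} \<Longrightarrow> tangent_at P C D"
| line_circle: "is_line C \<Longrightarrow> is_circle D \<Longrightarrow> C \<inter> D = {P} \<Longrightarrow> tangent_at P C D"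
| parallel_lines: "straight_line L \<Longrightarrow> straight_line M \<Longrightarrow> L \<noteq> M \<Longrightarrow> affine_parallel L M \<Longrightarrow>
    tangent_at None (ext_line L) (ext_line M)"
| point_left: "is_circle D \<or> is_line D \<Longrightarrow> P \<in> D \<Longrightarrow> tangent_at P {P} D"
| point_right: "is_circle C \<or> is_line C \<Longrightarrow> P \<in> C \<Longrightarrow> tangent_at P C {P}"

definition tangent :: "ext_plane set \<Rightarrow> ext_plane set \<Rightarrow> bool" where
  "tangent C D \<longleftrightarrow> (\<exists>P. tangent_at P C D)"

definition all_tangent_at_one_point :: "ext_plane set set \<Rightarrow> bool" where
  "all_tangent_at_one_point F \<longleftrightarrow> (\<exists>P. pairwise (tangent_at P) F)"

end

(*
  Moebius geometry: generalized circles are the unit vectors (circles and lines, up to sign) and the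
  null vectors (points, up to scaling) of a form of signature (3,1) on R^4, and tangency of v and w
  becomes <v,w>^2 = <v,v><w,w>. Suppose five vectors v_i are tangent to five vectors w_j; by symmetry
  let the v_i contain no point. If the v_i span R^4, a linear relation sum a_i v_i = 0 has to be
  annihilated by five different sign columns <v_i,w_j>, which by counting is possible only for
  a = (1,1,1,1,0) up to signs and order; then dual bases of the span lead to a contradiction. If the
  v_i span less, two w_j have equal sign columns (or the v_i lie on one affine line of the unit
  quadric), which produces a null vector n orthogonal to all v_i with all v_i congruent up to sign
  modulo n: a pencil of circles tangent at the point n.
*)
theory Submission
  imports Defs
begin

section \<open>The Lorentz form\<close>

text \<open>Tangent \<open>v\<close> and \<open>w\<close> span a plane on which the form
  degenerates, so for unit vectors \<open>lor v w\<close> is 1 or -1: what remains of the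
  configuration is a matrix of signs, to be played off against dimension 4. Two points are never
  tangent, so points occur in at most one family. If that is the given one, the pencil is found for
  the tangent circles and carried back, for which three of them suffice. A deficient span is the
  easier case, since an orthogonal vector is at hand. The obstacle is full span, where counting
  signs is not enough. With the overall sign fixed, the relation with coefficients 1, 1, 1, 1, 0
  admits six sign columns: three ways to halve the four vectors into opposite signs, each with a
  free sign at the fifth vector. Five columns miss only one of these, so two halvings occur with
  both fifth signs and the third at least once. This is enough to write down a dual basis, and
  comparing the Gram matrices of a basis and its dual gives inconsistent equations.\<close>

type_synonym lvec = "complex \<times> real \<times> real"

definition lor :: "lvec \<Rightarrow> lvec \<Rightarrow> real" where
  "lor x y = fst x \<bullet> fst y - fst (snd x) * snd (snd y) - snd (snd x) * fst (snd y)"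

lemma lor_commute: "lor x y = lor y x"
  by (simp add: lor_def inner_commute)

lemma lor_add_left: "lor (x + y) z = lor x z + lor y z"
  by (simp add: lor_def algebra_simps)

lemma lor_scaleR_left: "lor (r *\<^sub>R x) y = r * lor x y"
  by (simp add: lor_def algebra_simps)

lemma lor_add_right: "lor z (x + y) = lor z x + lor z y"
  by (metis lor_add_left lor_commute)

lemma lor_scaleR_right: "lor y (r *\<^sub>R x) = r * lor y x"
  by (metis lor_scaleR_left lor_commute)

lemma lor_minus_left: "lor (- x) y = - lor x y"
  using lor_scaleR_left[of "-1" x y] by simp

lemma lor_minus_right: "lor y (- x) = - lor y x"
  by (metis lor_minus_left lor_commute)

lemma lor_diff_left: "lor (x - y) z = lor x z - lor y z"
  using lor_add_left[of x "- y" z] by (simp add: lor_minus_left)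

lemma lor_diff_right: "lor z (x - y) = lor z x - lor z y"
  by (metis lor_diff_left lor_commute)

lemma lor_zero_left [simp]: "lor 0 x = 0"
  by (simp add: lor_def)

lemma lor_zero_right [simp]: "lor x 0 = 0"
  by (simp add: lor_def)

lemmas lor_linear = lor_add_left lor_add_right lor_scaleR_left lor_scaleR_right
  lor_minus_left lor_minus_right lor_diff_left lor_diff_right

text \<open>Turns the form into the Euclidean inner product, so that positive definiteness can be
  used in dimension counts for an indefinite form.\<close>

definition flat :: "lvec \<Rightarrow> lvec" where
  "flat x = (fst x, - snd (snd x), - fst (snd x))"

lemma lor_flat: "lor x (flat y) = x \<bullet> y"
  by (simp add: lor_def flat_def inner_prod_def)

text \<open>Signature (3,1) leaves no room for a totally isotropic plane. In coordinates: a null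
  vector with second entry 0 is a multiple of \<open>(0, 0, 1)\<close>, and otherwise subtracting a
  multiple of \<open>y\<close> makes the second entry of \<open>x\<close> vanish.\<close>

lemma null_orthogonal_imp_collinear:
  assumes "lor x x = 0" "lor y y = 0" "lor x y = 0" "y \<noteq> 0"
  obtains t where "x = t *\<^sub>R y"
proof -
  obtain c a d where x: "x = (c, a, d)" by (cases x)
  obtain c' a' d' where y: "y = (c', a', d')" by (cases y)
  have "\<exists>t. x = t *\<^sub>R y"
  proof (cases "a' = 0")
    case True
    then have "c' = 0" using assms(2) by (simp add: lor_def y)
    then have "d' \<noteq> 0" using assms(4) y True by (auto simp: zero_prod_def)
    then have "a = 0" using assms(3) \<open>c' = 0\<close> True by (simp add: lor_def x y)
    then have "c = 0" using assms(1) by (simp add: lor_def x)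
    then show ?thesis using \<open>a = 0\<close> \<open>c' = 0\<close> True \<open>d' \<noteq> 0\<close>
      by (intro exI[of _ "d / d'"]) (simp add: x y)
  next
    case False
    define z where "z = x - (a / a') *\<^sub>R y"
    have zz: "lor z z = 0" "lor z y = 0" using assms by (simp_all add: z_def lor_linear lor_commute)
    have "fst (snd z) = 0" using False by (simp add: z_def x y)
    then have "fst z = 0" using zz(1) by (simp add: lor_def)
    then have "snd (snd z) = 0" using zz(2) False \<open>fst (snd z) = 0\<close> by (simp add: lor_def y)
    then have "z = 0" using \<open>fst z = 0\<close> \<open>fst (snd z) = 0\<close> by (simp add: prod_eq_iff)
    then show ?thesis by (auto simp: z_def)
  qed
  then show ?thesis using that by blast
qed

lemma five_vectors_dependent:
  fixes x :: "nat \<Rightarrow> lvec"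
  obtains c i where "i < 5" "c i \<noteq> 0" "(\<Sum>i<5. c i *\<^sub>R x i) = 0"
proof (cases "inj_on x {..<5}")
  case True
  then have "card (x ` {..<5}) = 5" by (simp add: card_image)
  then have "dependent (x ` {..<5})" by (intro dependent_biggerset) simp
  then obtain u where u: "\<exists>v\<in>x ` {..<5}. u v \<noteq> 0" "(\<Sum>v\<in>x ` {..<5}. u v *\<^sub>R v) = 0"
    by (subst (asm) dependent_finite) auto
  then obtain i where "i < 5" "u (x i) \<noteq> 0" by auto
  moreover have "(\<Sum>i<5. u (x i) *\<^sub>R x i) = 0"
    using u(2) True by (simp add: sum.reindex)
  ultimately show ?thesis using that[of i "\<lambda>i. u (x i)"] by simp
next
  case False
  then obtain i j where ij: "i < 5" "j < 5" "i \<noteq> j" "x i = x j"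
    by (auto simp: inj_on_def)
  \<comment> \<open>A repeated vector is invisible to \<open>dependent\<close>, which speaks of
    sets; the relation is then the difference of the two equal members.\<close>
  define c where "c k = (if k = i then 1 else if k = j then -1 else 0 :: real)" for k
  have "(\<Sum>k<5. c k *\<^sub>R x k) = (\<Sum>k\<in>{i, j}. c k *\<^sub>R x k)"
    using ij by (intro sum.mono_neutral_right) (auto simp: c_def)
  also have "\<dots> = 0" using ij by (simp add: c_def)
  finally show ?thesis using that[of i c] ij by (simp add: c_def)
qed

lemma five_vectors_dependent_explicit:
  fixes x0 x1 x2 x3 x4 :: lvec
  obtains c0 c1 c2 c3 c4 where
    "c0 *\<^sub>R x0 + c1 *\<^sub>R x1 + c2 *\<^sub>R x2 + c3 *\<^sub>R x3 + c4 *\<^sub>R x4 = 0"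
    "c0 \<noteq> 0 \<or> c1 \<noteq> 0 \<or> c2 \<noteq> 0 \<or> c3 \<noteq> 0 \<or> c4 \<noteq> 0"
proof -
  obtain c i where c: "i < 5" "c i \<noteq> (0::real)"
    and s: "(\<Sum>i<5. c i *\<^sub>R [x0, x1, x2, x3, x4] ! i) = 0"
    by (rule five_vectors_dependent)
  have "c 0 *\<^sub>R x0 + c 1 *\<^sub>R x1 + c 2 *\<^sub>R x2 + c 3 *\<^sub>R x3 + c 4 *\<^sub>R x4 = 0"
    using s by (simp add: eval_nat_numeral)
  moreover have "i = 0 \<or> i = 1 \<or> i = 2 \<or> i = 3 \<or> i = 4"
    using c(1) by linarith
  ultimately show ?thesis using that c(2) by blast
qed

section \<open>Orthogonal complements of four and of three independent vectors\<close>

text \<open>In a linear relation between the four vectors and \<open>flat x\<close>, pairing with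
  \<open>x\<close> leaves only the Euclidean square of \<open>x\<close>.\<close>

lemma orthogonal_to_four_imp_zero:
  assumes indep: "\<forall>a b c d. a *\<^sub>R n1 + b *\<^sub>R n2 + c *\<^sub>R n3 + d *\<^sub>R n4 = 0 \<longrightarrow>
      a = 0 \<and> b = 0 \<and> c = 0 \<and> d = 0"
    and "lor x n1 = 0" "lor x n2 = 0" "lor x n3 = 0" "lor x n4 = 0"
  shows "x = 0"
proof -
  obtain a b c d e where
    eq: "a *\<^sub>R n1 + b *\<^sub>R n2 + c *\<^sub>R n3 + d *\<^sub>R n4 + e *\<^sub>R flat x = 0"
    and nz: "a \<noteq> 0 \<or> b \<noteq> 0 \<or> c \<noteq> 0 \<or> d \<noteq> 0 \<or> e \<noteq> 0"
    by (rule five_vectors_dependent_explicit)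
  have "lor x (a *\<^sub>R n1 + b *\<^sub>R n2 + c *\<^sub>R n3 + d *\<^sub>R n4 + e *\<^sub>R flat x) = 0"
    by (simp add: eq)
  then have "e * (x \<bullet> x) = 0" using assms by (simp add: lor_linear lor_flat)
  moreover have "e \<noteq> 0" using indep[rule_format, of a b c d] eq nz by auto
  ultimately show ?thesis by simp
qed

text \<open>A relation between the three vectors, \<open>flat x\<close> and \<open>flat y\<close>
  yields a combination \<open>z\<close> of \<open>x\<close> and \<open>y\<close> with
  \<open>flat z\<close> in the span of the three; pairing with \<open>z\<close> gives
  \<open>z \<bullet> z = 0\<close>.\<close>

lemma orthogonal_to_three_imp_collinear:
  assumes indep: "\<forall>a b c. a *\<^sub>R n1 + b *\<^sub>R n2 + c *\<^sub>R n3 = 0 \<longrightarrow> a = 0 \<and> b = 0 \<and> c = 0"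
    and x: "lor x n1 = 0" "lor x n2 = 0" "lor x n3 = 0"
    and y: "lor y n1 = 0" "lor y n2 = 0" "lor y n3 = 0"
    and "x \<noteq> 0"
  obtains t where "y = t *\<^sub>R x"
proof -
  obtain a b c d e where
    eq: "a *\<^sub>R n1 + b *\<^sub>R n2 + c *\<^sub>R n3 + d *\<^sub>R flat x + e *\<^sub>R flat y = 0"
    and nz: "a \<noteq> 0 \<or> b \<noteq> 0 \<or> c \<noteq> 0 \<or> d \<noteq> 0 \<or> e \<noteq> 0"
    by (rule five_vectors_dependent_explicit)
  let ?z = "d *\<^sub>R x + e *\<^sub>R y"
  have fz: "d *\<^sub>R flat x + e *\<^sub>R flat y = flat ?z"
    by (simp add: flat_def algebra_simps)
  have "lor ?z (a *\<^sub>R n1 + b *\<^sub>R n2 + c *\<^sub>R n3 + flat ?z) = 0"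
    using eq by (simp add: fz[symmetric] add.assoc)
  then have "?z \<bullet> ?z = 0" using x y by (simp add: lor_linear flip: lor_flat)
  then have z: "?z = 0" by simp
  then have "flat ?z = 0" by (simp add: flat_def zero_prod_def)
  then have "a = 0 \<and> b = 0 \<and> c = 0"
    using indep[rule_format, of a b c] eq fz by (simp add: add.assoc)
  moreover have "e \<noteq> 0"
  proof
    assume "e = 0"
    then show False using z \<open>x \<noteq> 0\<close> nz \<open>a = 0 \<and> b = 0 \<and> c = 0\<close> by auto
  qed
  moreover have "e *\<^sub>R y = (- d) *\<^sub>R x"
    using z by (simp add: add_eq_0_iff)
  ultimately have "y = inverse e *\<^sub>R ((- d) *\<^sub>R x)"
    by (metis left_inverse scaleR_one scaleR_scaleR)
  then show ?thesis using that[of "inverse e * - d"] by simp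
qed

section \<open>Tangent families and pencils\<close>

text \<open>\<open>n\<close> is the tangency point and \<open>u\<close> one circle or line through
  it. The form takes the value \<open>b * b\<close> at \<open>a n + b u\<close>, so up to sign the
  unit vectors of the span are \<open>u + a n\<close>, and its null vectors are the multiples of
  \<open>n\<close>.\<close>

definition pencil_frame :: "lvec \<Rightarrow> lvec \<Rightarrow> bool" where
  "pencil_frame n u \<longleftrightarrow> n \<noteq> 0 \<and> lor n n = 0 \<and> lor u u = 1 \<and> lor u n = 0"

text \<open>Subtracting \<open>u\<close> with the sign \<open>lor x u\<close> leaves a null vector
  orthogonal to \<open>n\<close>, hence a multiple of \<open>n\<close>.\<close>

lemma orthogonal_unit_in_pencil:
  assumes fr: "pencil_frame n u"
    and x: "lor x n = 0" "lor x x = 1" "(lor x u)\<^sup>2 = 1"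
  shows "x \<in> span {n, u}"
proof -
  have "lor x u = 1 \<or> lor x u = -1" using x(3) by (simp add: power2_eq_1_iff)
  then obtain s where s: "s = 1 \<or> s = -1" "lor x u = s" by auto
  let ?y = "x - s *\<^sub>R u"
  have "lor ?y ?y = 0" "lor ?y n = 0"
    using fr x s by (auto simp: lor_linear pencil_frame_def lor_commute)
  then obtain t where "?y = t *\<^sub>R n"
    using fr null_orthogonal_imp_collinear[of ?y n] by (auto simp: pencil_frame_def)
  then have "x = t *\<^sub>R n + s *\<^sub>R u" by (simp add: algebra_simps)
  then show ?thesis
    by (simp add: span_add span_base span_scale)
qed

text \<open>Only the \<open>w\<close>s may be points, so the factor \<open>lor (v i) (v i)\<close>
  drops out of the tangency equation. Unit vectors are proportional only if equal up to sign, while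
  null vectors have no preferred scale; hence the two forms of distinctness.\<close>

locale tangent_families =
  fixes v w :: "nat \<Rightarrow> lvec"
  assumes v_unit: "i < 5 \<Longrightarrow> lor (v i) (v i) = 1"
    and v_distinct: "i < 5 \<Longrightarrow> j < 5 \<Longrightarrow> i \<noteq> j \<Longrightarrow> v i \<noteq> v j \<and> v i \<noteq> - v j"
    and w_nonzero: "i < 5 \<Longrightarrow> w i \<noteq> 0"
    and w_unit_or_null: "i < 5 \<Longrightarrow> lor (w i) (w i) = 1 \<or> lor (w i) (w i) = 0"
    and w_distinct: "i < 5 \<Longrightarrow> j < 5 \<Longrightarrow> i \<noteq> j \<Longrightarrow> w i \<noteq> t *\<^sub>R w j"
    and tangency: "i < 5 \<Longrightarrow> j < 5 \<Longrightarrow> (lor (v i) (w j))\<^sup>2 = lor (w j) (w j)"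
begin

lemma null_w_orthogonal: "i < 5 \<Longrightarrow> j < 5 \<Longrightarrow> lor (w j) (w j) = 0 \<Longrightarrow> lor (v i) (w j) = 0"
  using tangency[of i j] by simp

lemma unit_w_sign: "i < 5 \<Longrightarrow> j < 5 \<Longrightarrow> lor (w j) (w j) = 1 \<Longrightarrow>
    lor (v i) (w j) = 1 \<or> lor (v i) (w j) = -1"
  using tangency[of i j] by (simp add: power2_eq_1_iff)

lemma v_not_scaled: "i < 5 \<Longrightarrow> j < 5 \<Longrightarrow> i \<noteq> j \<Longrightarrow> v i \<noteq> t *\<^sub>R v j"
proof
  assume ij: "i < 5" "j < 5" "i \<noteq> j" "v i = t *\<^sub>R v j"
  then have "t * t = 1" using v_unit[of i] v_unit[of j] by (simp add: lor_linear)
  then have "t = 1 \<or> t = -1" by (metis power2_eq_1_iff power2_eq_square)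
  then show False using v_distinct[OF ij(1-3)] ij(4) by auto
qed

text \<open>Only one circle or line passes through three points. Distinct points are never
  orthogonal, so the Gram matrix of three has zero diagonal and nonzero entries elsewhere and is
  invertible; the complement, which holds all \<open>v i\<close>, is then a line.\<close>

lemma w_not_all_null:
  assumes "i < 5" "j < 5" "k < 5" "i \<noteq> j" "j \<noteq> k" "i \<noteq> k"
    and n: "lor (w i) (w i) = 0" "lor (w j) (w j) = 0" "lor (w k) (w k) = 0"
  shows False
proof -
  have nz: "lor (w p) (w q) \<noteq> 0" if "p < 5" "q < 5" "p \<noteq> q" "lor (w p) (w p) = 0" "lor (w q) (w q) = 0" for p q
    using null_orthogonal_imp_collinear[of "w p" "w q"] that w_nonzero w_distinct[OF that(1-3)] by metis
  have ne: "lor (w i) (w j) \<noteq> 0" "lor (w i) (w k) \<noteq> 0" "lor (w j) (w k) \<noteq> 0"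
    using nz[of i j] nz[of i k] nz[of j k] assms by simp_all
  have indep: "\<forall>a b c. a *\<^sub>R w i + b *\<^sub>R w j + c *\<^sub>R w k = 0 \<longrightarrow> a = 0 \<and> b = 0 \<and> c = 0"
  proof (intro allI impI)
    fix a b c assume e: "a *\<^sub>R w i + b *\<^sub>R w j + c *\<^sub>R w k = 0"
    have "lor (a *\<^sub>R w i + b *\<^sub>R w j + c *\<^sub>R w k) (w p) = 0" for p
      by (simp add: e)
    from this[of i] this[of j] this[of k]
    have l: "b * lor (w i) (w j) + c * lor (w i) (w k) = 0"
      "a * lor (w i) (w j) + c * lor (w j) (w k) = 0"
      "a * lor (w i) (w k) + b * lor (w j) (w k) = 0"
      using n by (simp_all add: lor_linear lor_commute)
    have "2 * a * (lor (w i) (w j) * lor (w i) (w k)) =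
      lor (w i) (w k) * (a * lor (w i) (w j) + c * lor (w j) (w k))
      + lor (w i) (w j) * (a * lor (w i) (w k) + b * lor (w j) (w k))
      - lor (w j) (w k) * (b * lor (w i) (w j) + c * lor (w i) (w k))"
      by (simp add: algebra_simps)
    then have "a = 0" using ne unfolding l by simp
    then show "a = 0 \<and> b = 0 \<and> c = 0" using l ne by simp
  qed
  obtain t where "v 1 = t *\<^sub>R v 0"
  proof (rule orthogonal_to_three_imp_collinear[OF indep, of "v 0" "v 1"])
    show "v 0 \<noteq> 0" using v_unit[of 0] by auto
  qed (use assms null_w_orthogonal in auto)
  then show False using v_not_scaled[of 1 0] by auto
qed

text \<open>Normalising all signs to \<open>lor (v i) (w j) = 1\<close> puts the five vectors on one affine line;
  a line meeting the unit quadric three times is a null line inside it.\<close>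
lemma pencil_if_complement_ge_two:
  assumes n: "\<And>i. i < 5 \<Longrightarrow> lor n (v i) = 0" and n': "\<And>i. i < 5 \<Longrightarrow> lor n' (v i) = 0"
    and nn': "\<And>a b. a *\<^sub>R n + b *\<^sub>R n' = 0 \<Longrightarrow> a = 0 \<and> b = 0"
  shows "\<exists>n u. pencil_frame n u \<and> (\<forall>i<5. v i \<in> span {n, u})"
proof -
  have "\<exists>j<5. lor (w j) (w j) = 1"
  proof (rule ccontr)
    assume "\<not> ?thesis"
    then have "lor (w j) (w j) = 0" if "j < 5" for j using w_unit_or_null that by blast
    then show False by (intro w_not_all_null[of 0 1 2]) simp_all
  qed
  then obtain j where j: "j < 5" "lor (w j) (w j) = 1" by blast
  define e where "e i = lor (v i) (w j)" for i
  have e: "e i = 1 \<or> e i = -1" if "i < 5" for i using unit_w_sign that j by (simp add: e_def)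
  define u where "u i = e i *\<^sub>R v i" for i
  have uw: "lor (u i) (w j) = 1" and uu: "lor (u i) (u i) = 1"
    and un: "lor (u i) n = 0" "lor (u i) n' = 0" if "i < 5" for i
    using e[OF that] v_unit[OF that] n[OF that] n'[OF that]
    by (auto simp: u_def lor_linear lor_commute e_def)
  have v_u: "v i = e i *\<^sub>R u i" if "i < 5" for i using e[OF that] by (auto simp: u_def)
  have u_ne: "u i \<noteq> u k" if "i < 5" "k < 5" "i \<noteq> k" for i k
    using v_distinct[OF that] e[OF that(1)] e[OF that(2)]
    by (auto simp: u_def) (metis minus_minus)+
  have indep: "\<forall>a b c. a *\<^sub>R w j + b *\<^sub>R n + c *\<^sub>R n' = 0 \<longrightarrow> a = 0 \<and> b = 0 \<and> c = 0"
  proof (intro allI impI)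
    fix a b c assume eq: "a *\<^sub>R w j + b *\<^sub>R n + c *\<^sub>R n' = 0"
    have "lor (u 0) (a *\<^sub>R w j + b *\<^sub>R n + c *\<^sub>R n') = 0" by (simp add: eq)
    then have "a = 0" using un[of 0] uw[of 0] by (simp add: lor_linear)
    then show "a = 0 \<and> b = 0 \<and> c = 0" using nn'[of b c] eq by simp
  qed
  define d where "d = u 1 - u 0"
  have "d \<noteq> 0" using u_ne[of 1 0] by (simp add: d_def)
  have line: "\<exists>t. u i = u 0 + t *\<^sub>R d" if i: "i < 5" for i
  proof -
    obtain t where "u i - u 0 = t *\<^sub>R d"
    proof (rule orthogonal_to_three_imp_collinear[OF indep, of d "u i - u 0"])
      show "d \<noteq> 0" by fact
    qed (use un uw i in \<open>auto simp: d_def lor_linear\<close>)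
    then show ?thesis by (metis add.commute diff_add_cancel)
  qed
  obtain t where t: "u 2 = u 0 + t *\<^sub>R d" using line[of 2] by auto
  have u1: "u 1 = u 0 + d" by (simp add: d_def)
  have t0: "t \<noteq> 0" using t u_ne[of 2 0] by auto
  have t1: "t \<noteq> 1" using t u1 u_ne[of 2 1] by auto
  \<comment> \<open>Along the line the form is a quadratic polynomial of the parameter. It equals 1
    at 0, 1 and \<open>t\<close>, so its linear and quadratic coefficients vanish: \<open>d\<close>
    is null and orthogonal to \<open>u 0\<close>.\<close>
  have q1: "2 * lor (u 0) d + lor d d = 0"
    using uu[of 1] uu[of 0] unfolding u1 by (simp add: lor_linear lor_commute)
  have "t * (2 * lor (u 0) d + t * lor d d) = 0"
    using uu[of 2] uu[of 0] unfolding t by (simp add: lor_linear lor_commute algebra_simps)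
  then have q2: "2 * lor (u 0) d + t * lor d d = 0" using t0 by simp
  have "(t - 1) * lor d d = (2 * lor (u 0) d + t * lor d d) - (2 * lor (u 0) d + lor d d)"
    by (simp add: algebra_simps)
  then have "(t - 1) * lor d d = 0" unfolding q1 q2 by simp
  then have "lor d d = 0" using t1 by simp
  then have fr: "pencil_frame d (u 0)"
    using q1 \<open>d \<noteq> 0\<close> uu[of 0] by (simp add: pencil_frame_def)
  have "v i \<in> span {d, u 0}" if i: "i < 5" for i
  proof -
    obtain t where t: "u i = u 0 + t *\<^sub>R d" using line[OF i] by auto
    have "u i \<in> span {d, u 0}" unfolding t by (intro span_add span_scale span_base) auto
    then show ?thesis using v_u[OF i] by (metis span_scale)
  qed
  with fr show ?thesis by blast
qed

end

section \<open>Families with a one-dimensional orthogonal complement\<close>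

text \<open>Multiplying row \<open>i\<close> by \<open>e1 i\<close> gives
  \<open>a + b r + c r' = 0\<close> with signs \<open>r\<close>, \<open>r'\<close>. For nonzero
  coefficients two different solutions are impossible, since they would force a coefficient to
  vanish; so \<open>r\<close> and \<open>r'\<close> are the same in all rows and the columns are
  proportional. A zero coefficient leaves two columns.\<close>

lemma sign_columns_independent:
  fixes e1 e2 e3 :: "nat \<Rightarrow> real"
  assumes s: "\<And>i. i < 5 \<Longrightarrow> e1 i = 1 \<or> e1 i = -1" "\<And>i. i < 5 \<Longrightarrow> e2 i = 1 \<or> e2 i = -1"
      "\<And>i. i < 5 \<Longrightarrow> e3 i = 1 \<or> e3 i = -1"
    and d12: "\<And>s. \<exists>i<5. e1 i \<noteq> s * e2 i"
    and d13: "\<And>s. \<exists>i<5. e1 i \<noteq> s * e3 i"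
    and d23: "\<And>s. \<exists>i<5. e2 i \<noteq> s * e3 i"
    and c: "\<And>i. i < 5 \<Longrightarrow> a * e1 i + b * e2 i + c * e3 i = 0"
  shows "a = 0 \<and> b = 0 \<and> c = 0"
proof -
  have two: "x = 0 \<and> y = 0" if f: "\<And>i. i < 5 \<Longrightarrow> f i = 1 \<or> f i = -1"
    and g: "\<And>i. i < 5 \<Longrightarrow> g i = 1 \<or> g i = -1"
    and d: "\<And>s. \<exists>i<5. f i \<noteq> s * g i"
    and xy: "\<And>i. i < 5 \<Longrightarrow> x * f i + y * g i = 0" for f g :: "nat \<Rightarrow> real" and x y
  proof (rule ccontr)
    assume ne: "\<not> (x = 0 \<and> y = 0)"
    have "x \<noteq> 0"
    proof
      assume "x = 0"
      then have "y * g 0 = 0" using xy[of 0] by simp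
      then show False using g[of 0] ne \<open>x = 0\<close> by auto
    qed
    then have "f i = (- y / x) * g i" if "i < 5" for i
      using xy[OF that] by (simp add: field_simps)
    then show False using d[of "- y / x"] by blast
  qed
  consider "a = 0" | "b = 0" | "c = 0" | "a \<noteq> 0" "b \<noteq> 0" "c \<noteq> 0" by blast
  then show ?thesis
  proof cases
    case 1
    then show ?thesis using two[OF s(2,3) d23, of b c] c by simp
  next
    case 2
    then show ?thesis using two[OF s(1,3) d13, of a c] c by simp
  next
    case 3
    then show ?thesis using two[OF s(1,2) d12, of a b] c by simp
  next
    case 4
    have r: "e1 i * e2 i = e1 0 * e2 0 \<and> e1 i * e3 i = e1 0 * e3 0" if "i < 5" for i
      using c[OF that] c[of 0] s[OF that] s[of 0] 4 by auto
    have "e1 i = (e1 0 * e2 0) * e2 i" if "i < 5" for i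
    proof -
      have "e1 i = e1 i * e2 i * e2 i" using s(2)[OF that] by auto
      then show ?thesis using r[OF that] by simp
    qed
    then show ?thesis using d12[of "e1 0 * e2 0"] by blast
  qed
qed

context tangent_families
begin

text \<open>Unit \<open>w\<close>s with proportional sign columns differ, up to sign, by a multiple
  of \<open>n\<close>. Comparing norms along \<open>w + t n\<close> makes \<open>n\<close> null and
  orthogonal to a unit \<open>w j\<close> as soon as some \<open>w\<close> is a point or some
  \<open>w\<close> has two such partners.\<close>

lemma pencil_if_complement_one:
  assumes n0: "n \<noteq> 0" and n: "\<And>i. i < 5 \<Longrightarrow> lor n (v i) = 0"
    and perp: "\<And>x. (\<And>i. i < 5 \<Longrightarrow> lor x (v i) = 0) \<Longrightarrow> \<exists>t. x = t *\<^sub>R n"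
  shows "\<exists>n u. pencil_frame n u \<and> (\<forall>i<5. v i \<in> span {n, u})"
proof -
  define unit where "unit j \<longleftrightarrow> j < 5 \<and> lor (w j) (w j) = 1" for j
  have unit_less: "j < 5" if "unit j" for j using that by (simp add: unit_def)
  \<comment> \<open>For distinct unit vectors this says that the sign columns are proportional,
    written as a translation along \<open>n\<close>; the shift is nonzero because no two
    \<open>w\<close>s are proportional.\<close>
  define E where "E j k \<longleftrightarrow> (\<exists>s t. (s = 1 \<or> s = -1) \<and> t \<noteq> 0 \<and> w j = s *\<^sub>R (w k + t *\<^sub>R n))" for j k
  have E_I: "E j k" if u: "unit j" "unit k" "j \<noteq> k" and eq: "\<And>i. i < 5 \<Longrightarrow> lor (v i) (w j) = s * lor (v i) (w k)" for j k s
  proof -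
    have jk: "j < 5" "k < 5" using u by (simp_all add: unit_def)
    have "s = 1 \<or> s = -1"
      using eq[of 0] unit_w_sign[of 0 j] unit_w_sign[of 0 k] u by (auto simp: unit_def)
    moreover obtain t where t: "w j - s *\<^sub>R w k = t *\<^sub>R n"
      using perp[of "w j - s *\<^sub>R w k"] eq by (auto simp: lor_linear lor_commute)
    moreover have "t \<noteq> 0" using t w_distinct[OF jk \<open>j \<noteq> k\<close>, of s] by auto
    moreover have "w j = s *\<^sub>R (w k + (s * t) *\<^sub>R n)"
    proof -
      have "w j = s *\<^sub>R w k + t *\<^sub>R n" using t by (simp add: algebra_simps)
      then show ?thesis using \<open>s = 1 \<or> s = -1\<close> by auto
    qed
    ultimately show ?thesis unfolding E_def by (intro exI[of _ s] exI[of _ "s * t"]) auto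
  qed
  have E_sym: "E k j" if jk: "E j k" for j k
  proof -
    obtain s t where st: "s = 1 \<or> s = -1" "t \<noteq> 0" "w j = s *\<^sub>R (w k + t *\<^sub>R n)"
      using jk unfolding E_def by blast
    then have "w k = s *\<^sub>R (w j + (- s * t) *\<^sub>R n)" by (auto simp: algebra_simps)
    then show ?thesis unfolding E_def using st by (intro exI[of _ s] exI[of _ "- s * t"]) auto
  qed
  have E_norm: "2 * lor (w k) n + t * lor n n = 0"
    if "unit j" "unit k" "s = 1 \<or> s = -1" "t \<noteq> 0" "w j = s *\<^sub>R (w k + t *\<^sub>R n)" for j k s t
  proof -
    have "lor (w j) (w j) = 1" "lor (w k) (w k) = 1" using that by (simp_all add: unit_def)
    then have "t * (2 * lor (w k) n + t * lor n n) = 0"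
      using that(3) unfolding that(5) by (auto simp: lor_linear lor_commute algebra_simps)
    then show ?thesis using \<open>t \<noteq> 0\<close> by simp
  qed
  have two_of_three: "E j k \<or> E j l \<or> E k l"
    if u: "unit j" "unit k" "unit l" and d: "j \<noteq> k" "j \<noteq> l" "k \<noteq> l" for j k l
  proof (rule ccontr)
    assume "\<not> ?thesis"
    then have nE: "\<not> E j k" "\<not> E j l" "\<not> E k l" by auto
    have sg: "lor (v i) (w p) = 1 \<or> lor (v i) (w p) = -1" if "i < 5" "unit p" for i p
      using unit_w_sign that by (simp add: unit_def)
    have ind: "a = 0 \<and> b = 0 \<and> c = 0"
      if "\<And>i. i < 5 \<Longrightarrow> a * lor (v i) (w j) + b * lor (v i) (w k) + c * lor (v i) (w l) = 0" for a b c
    proof (rule sign_columns_independent)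
      show "\<exists>i<5. lor (v i) (w j) \<noteq> s * lor (v i) (w k)" for s
        using E_I[OF u(1,2) d(1), of s] nE by blast
      show "\<exists>i<5. lor (v i) (w j) \<noteq> s * lor (v i) (w l)" for s
        using E_I[OF u(1,3) d(2), of s] nE by blast
      show "\<exists>i<5. lor (v i) (w k) \<noteq> s * lor (v i) (w l)" for s
        using E_I[OF u(2,3) d(3), of s] nE by blast
    qed (use sg u that in auto)
    have indep: "\<forall>a b c d. a *\<^sub>R w j + b *\<^sub>R w k + c *\<^sub>R w l + d *\<^sub>R n = 0 \<longrightarrow>
        a = 0 \<and> b = 0 \<and> c = 0 \<and> d = 0"
    proof (intro allI impI)
      fix a b c d assume e: "a *\<^sub>R w j + b *\<^sub>R w k + c *\<^sub>R w l + d *\<^sub>R n = 0"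
      have "a * lor (v i) (w j) + b * lor (v i) (w k) + c * lor (v i) (w l) = 0" if i: "i < 5" for i
      proof -
        have "lor (v i) (a *\<^sub>R w j + b *\<^sub>R w k + c *\<^sub>R w l + d *\<^sub>R n) = 0" by (simp add: e)
        then show ?thesis using n[OF i] by (simp add: lor_linear lor_commute)
      qed
      from ind[OF this] show "a = 0 \<and> b = 0 \<and> c = 0 \<and> d = 0" using e n0 by simp
    qed
    \<comment> \<open>Up to overall sign, the signs of \<open>v i\<close> against three columns take
      only four values, so two of the five \<open>v\<close>s agree up to sign on a basis.\<close>
    define r where "r i = (lor (v i) (w j) * lor (v i) (w k), lor (v i) (w j) * lor (v i) (w l))" for i
    have "r i \<in> {1, -1} \<times> {1, -1}" if i: "i < 5" for i
      using sg[OF i u(1)] sg[OF i u(2)] sg[OF i u(3)] by (auto simp: r_def)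
    then have "r ` {..<5} \<subseteq> {1, -1} \<times> {1, -1}" by blast
    then have "card (r ` {..<5}) \<le> card ({1, -1::real} \<times> {1, -1::real})"
      by (intro card_mono) auto
    then have "\<not> inj_on r {..<5}"
      by (intro pigeonhole) (simp add: card_cartesian_product)
    then obtain p q where pq: "p < 5" "q < 5" "p \<noteq> q" "r p = r q" by (auto simp: inj_on_def)
    define s where "s = lor (v p) (w j) * lor (v q) (w j)"
    let ?x = "v p - s *\<^sub>R v q"
    have "?x = 0"
    proof (rule orthogonal_to_four_imp_zero[OF indep])
      note sg6 = sg[OF pq(1) u(1)] sg[OF pq(1) u(2)] sg[OF pq(1) u(3)]
        sg[OF pq(2) u(1)] sg[OF pq(2) u(2)] sg[OF pq(2) u(3)]
      show "lor ?x (w j) = 0" "lor ?x (w k) = 0" "lor ?x (w l) = 0"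
        using sg6 pq(4) by (auto simp: lor_linear s_def r_def)
      show "lor ?x n = 0" using n pq by (simp add: lor_linear lor_commute)
    qed
    then show False using v_not_scaled[OF pq(1-3), of s] by simp
  qed
  have "\<exists>j. unit j \<and> lor n n = 0 \<and> lor (w j) n = 0"
  proof (cases "\<exists>m<5. lor (w m) (w m) = 0")
    case True
    then obtain m where m: "m < 5" "lor (w m) (w m) = 0" by blast
    obtain t where t: "w m = t *\<^sub>R n"
      using perp[of "w m"] null_w_orthogonal[OF _ m] by (auto simp: lor_commute)
    then have "t \<noteq> 0" using w_nonzero[OF m(1)] by auto
    then have nn: "lor n n = 0" using m(2) t by (simp add: lor_linear)
    have unit: "unit k" if k: "k < 5" "k \<noteq> m" for k
    proof (rule ccontr)
      assume "\<not> unit k"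
      then have "lor (w k) (w k) = 0" using w_unit_or_null[OF k(1)] k by (auto simp: unit_def)
      then obtain t' where "w k = t' *\<^sub>R n"
        using perp[of "w k"] null_w_orthogonal[OF _ k(1)] by (auto simp: lor_commute)
      then have "w k = (t' / t) *\<^sub>R w m" using t \<open>t \<noteq> 0\<close> by simp
      then show False using w_distinct[OF k(1) m(1) k(2)] by blast
    qed
    \<comment> \<open>The three smallest indices other than \<open>m\<close>.\<close>
    define j k l :: nat where "j = (if m = 0 then 1 else 0)" and
      "k = (if m \<le> 1 then 2 else 1)" and "l = (if m \<le> 2 then 3 else 2)"
    have "unit j" "unit k" "unit l" "j \<noteq> k" "j \<noteq> l" "k \<noteq> l"
      by (auto intro!: unit simp: j_def k_def l_def split: if_splits)
    then have "\<exists>j k. unit j \<and> unit k \<and> E j k" using two_of_three by blast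
    then obtain j k s t where "unit j" "unit k" "s = 1 \<or> s = -1" "t \<noteq> 0" "w j = s *\<^sub>R (w k + t *\<^sub>R n)"
      unfolding E_def by blast
    then have "lor (w k) n = 0" using E_norm[of j k s t] nn by simp
    then show ?thesis using nn \<open>unit k\<close> by blast
  next
    case False
    then have unit: "unit j" if "j < 5" for j
      using that w_unit_or_null[OF that] by (auto simp: unit_def)
    \<comment> \<open>Two partners of \<open>w j\<close> give two distinct roots of the norm
      equation, which is linear after division by \<open>t\<close>; so both its coefficients
      vanish.\<close>
    have three: ?thesis if jkl: "j < 5" "k < 5" "l < 5" "k \<noteq> l" "E k j" "E l j" for j k l
    proof -
      obtain s t where st: "s = 1 \<or> s = -1" "t \<noteq> 0" "w k = s *\<^sub>R (w j + t *\<^sub>R n)"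
        using jkl(5) unfolding E_def by blast
      obtain s' t' where st': "s' = 1 \<or> s' = -1" "t' \<noteq> 0" "w l = s' *\<^sub>R (w j + t' *\<^sub>R n)"
        using jkl(6) unfolding E_def by blast
      have "t \<noteq> t'"
      proof
        assume "t = t'"
        then have "w l = (s' * s) *\<^sub>R w k" using st st' by auto
        then show False using w_distinct[OF jkl(3,2)] jkl(4) by auto
      qed
      moreover have q: "2 * lor (w j) n + t * lor n n = 0" "2 * lor (w j) n + t' * lor n n = 0"
        using E_norm[OF _ _ st] E_norm[OF _ _ st'] unit jkl by auto
      moreover have "(t - t') * lor n n = (2 * lor (w j) n + t * lor n n) - (2 * lor (w j) n + t' * lor n n)"
        by (simp add: algebra_simps)
      then have "(t - t') * lor n n = 0" unfolding q by simp
      ultimately show ?thesis using unit[OF jkl(1)] by auto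
    qed
    show ?thesis
    \<comment> \<open>A graph on five vertices with an edge among any three has a vertex of degree 2
      or more. If 0 lacks two neighbours among 1, 2, 3, it misses two of them; these are adjacent,
      and each of the two remaining vertices is adjacent to 0 or to the smaller of the pair.\<close>
    proof (cases "E 1 0 \<and> E 2 0 \<or> E 1 0 \<and> E 3 0 \<or> E 2 0 \<and> E 3 0")
      case True
      then show ?thesis using three[of 0 1 2] three[of 0 1 3] three[of 0 2 3] by auto
    next
      case False
      have tw: "E j k \<or> E j l \<or> E k l" if "j < 5" "k < 5" "l < 5" "j \<noteq> k" "j \<noteq> l" "k \<noteq> l" for j k l
        using two_of_three unit that by blast
      consider "\<not> E 1 0" "\<not> E 2 0" | "\<not> E 1 0" "\<not> E 3 0" | "\<not> E 2 0" "\<not> E 3 0"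
        using False by blast
      then show ?thesis
      proof cases
        case 1
        have a: "E 2 1" using tw[of 2 1 0] 1 by auto
        have b: "E 3 0 \<or> E 3 1" "E 4 0 \<or> E 4 1" using tw[of 3 1 0] tw[of 4 1 0] 1 by auto
        show ?thesis using b three[of 0 3 4] three[of 1 2 3] three[of 1 2 4] a by auto
      next
        case 2
        have a: "E 3 1" using tw[of 3 1 0] 2 by auto
        have b: "E 2 0 \<or> E 2 1" "E 4 0 \<or> E 4 1" using tw[of 2 1 0] tw[of 4 1 0] 2 by auto
        show ?thesis using b three[of 0 2 4] three[of 1 2 3] three[of 1 3 4] a by auto
      next
        case 3
        have a: "E 3 2" using tw[of 3 2 0] 3 by auto
        have b: "E 1 0 \<or> E 1 2" "E 4 0 \<or> E 4 2" using tw[of 1 2 0] tw[of 4 2 0] 3 by auto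
        show ?thesis using b three[of 0 1 4] three[of 2 1 3] three[of 2 3 4] a by auto
      qed
    qed
  qed
  then obtain j where j: "unit j" "lor n n = 0" "lor (w j) n = 0" by blast
  then have "pencil_frame n (w j)" using n0 by (simp add: pencil_frame_def unit_def)
  moreover have "v i \<in> span {n, w j}" if "i < 5" for i
    using orthogonal_unit_in_pencil[OF \<open>pencil_frame n (w j)\<close>, of "v i"] n[OF that] v_unit[OF that]
      tangency[OF that, of j] j by (simp add: lor_commute unit_def)
  ultimately show ?thesis by blast
qed

end

section \<open>Families spanning the whole space\<close>

text \<open>\<open>a\<close>, \<open>a'\<close> and \<open>b\<close>, \<open>b'\<close> are two
  halvings with both fifth signs, \<open>c\<close> is one column of the third. The vectors
  \<open>p\<close>, \<open>q\<close>, \<open>r\<close> attached to the halvings are pairwise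
  orthogonal with squares adding up to 4; expanding \<open>p\<close>, \<open>q\<close>,
  \<open>r\<close>, \<open>v5\<close> in the dual basis gives equations in \<open>R\<close>,
  \<open>nu\<close>, \<open>h\<close>, \<open>k\<close> without a solution.\<close>

lemma exceptional_configuration_impossible:
  assumes span: "\<And>x. lor x v1 = 0 \<Longrightarrow> lor x v2 = 0 \<Longrightarrow> lor x v3 = 0 \<Longrightarrow> lor x v4 = 0 \<Longrightarrow>
      lor x v5 = 0 \<Longrightarrow> x = 0"
    and sum0: "v1 + v2 + v3 + v4 = 0"
    and vv: "lor v1 v1 = 1" "lor v2 v2 = 1" "lor v3 v3 = 1" "lor v4 v4 = 1" "lor v5 v5 = 1"
    and ww: "lor a a = 1" "lor a' a' = 1" "lor b b = 1" "lor b' b' = 1" "lor c c = 1"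
    and a: "lor a v1 = 1" "lor a v2 = 1" "lor a v3 = -1" "lor a v4 = -1" "lor a v5 = 1"
    and a': "lor a' v1 = 1" "lor a' v2 = 1" "lor a' v3 = -1" "lor a' v4 = -1" "lor a' v5 = -1"
    and b: "lor b v1 = 1" "lor b v2 = -1" "lor b v3 = 1" "lor b v4 = -1" "lor b v5 = 1"
    and b': "lor b' v1 = 1" "lor b' v2 = -1" "lor b' v3 = 1" "lor b' v4 = -1" "lor b' v5 = -1"
    and c: "lor c v1 = 1" "lor c v2 = -1" "lor c v3 = -1" "lor c v4 = 1" "lor c v5 = 1"
  shows False
proof -
  define p q r where "p = v1 + v2" and "q = v1 + v3" and "r = v1 + v4"
  define P Q R where "P = lor p p" and "Q = lor q q" and "R = lor r r"
  define n where "n = a - a'"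
  define nu where "nu = lor n n"
  have v4: "v4 = - (v1 + v2 + v3)" using sum0 by (metis add_eq_0_iff)
  have rel: "lor v1 v2 + lor v1 v3 + lor v2 v3 = -1"
    using vv unfolding v4 by (simp add: lor_linear lor_commute)
  \<comment> \<open>Both differences pair to 0 with \<open>v1\<close>, ..., \<open>v4\<close> and to
    2 with \<open>v5\<close>; their coincidence links the two halvings.\<close>
  have "n - (b - b') = 0"
    by (rule span) (simp_all add: n_def lor_linear a a' b b')
  then have n2: "n = b - b'" by simp
  have nv: "lor n v1 = 0" "lor n v2 = 0" "lor n v3 = 0" "lor n v4 = 0" "lor n v5 = 2"
    by (simp_all add: n_def lor_linear a a')
  \<comment> \<open>The orthogonality is the unit norm of \<open>v4\<close>, in the form
    \<open>rel\<close>.\<close>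
  have pqr: "lor p q = 0" "lor p r = 0" "lor q r = 0"
    using rel vv by (simp_all add: p_def q_def r_def v4 lor_linear lor_commute)
  have PQR: "P + Q + R = 4"
    using rel vv by (simp add: P_def Q_def R_def p_def q_def r_def v4 lor_linear lor_commute)
  have span': "x = 0" if "lor x p = 0" "lor x q = 0" "lor x r = 0" "lor x v5 = 0" for x
  proof (rule span)
    have "lor x p + lor x q + lor x r = 2 * lor x v1"
      by (simp add: p_def q_def r_def v4 lor_linear)
    then show "lor x v1 = 0" using that by simp
    then show "lor x v2 = 0" "lor x v3 = 0" "lor x v4 = 0" "lor x v5 = 0"
      using that by (simp_all add: p_def q_def r_def lor_linear)
  qed
  \<comment> \<open>\<open>(ps, qs, rs, n / 2)\<close> is the basis dual to \<open>(p, q, r, v5)\<close>.\<close>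
  define ps qs rs where "ps = (1/4) *\<^sub>R (a + a')" and "qs = (1/4) *\<^sub>R (b + b')"
    and "rs = (1/2) *\<^sub>R (c - (1/2) *\<^sub>R n)"
  have dual: "lor ps p = 1" "lor ps q = 0" "lor ps r = 0" "lor ps v5 = 0"
    "lor qs p = 0" "lor qs q = 1" "lor qs r = 0" "lor qs v5 = 0"
    "lor rs p = 0" "lor rs q = 0" "lor rs r = 1" "lor rs v5 = 0"
    "lor n p = 0" "lor n q = 0" "lor n r = 0" "lor n v5 = 2"
    by (simp_all add: ps_def qs_def rs_def p_def q_def r_def lor_linear nv a a' b b' c)
  have expand: "x = lor x p *\<^sub>R ps + lor x q *\<^sub>R qs + lor x r *\<^sub>R rs + (lor x v5 / 2) *\<^sub>R n" for x
  proof -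
    have "x - (lor x p *\<^sub>R ps + lor x q *\<^sub>R qs + lor x r *\<^sub>R rs + (lor x v5 / 2) *\<^sub>R n) = 0"
      by (rule span') (simp_all add: lor_linear dual)
    then show ?thesis by simp
  qed
  have "nu = lor (a - a') (a - a')" "nu = lor (b - b') (b - b')"
    by (simp_all add: nu_def n_def n2[symmetric])
  then have "nu = 2 - 2 * lor a a'" "nu = 2 - 2 * lor b b'"
    using ww by (simp_all add: lor_linear lor_commute)
  then have orth: "lor ps n = 0" "lor ps ps = (4 - nu) / 16" "lor qs n = 0" "lor qs qs = (4 - nu) / 16"
  proof -
    show "lor ps n = 0" "lor ps ps = (4 - nu) / 16" if "nu = 2 - 2 * lor a a'"
      using ww that by (simp_all add: ps_def n_def lor_linear lor_commute)
    show "lor qs n = 0" "lor qs qs = (4 - nu) / 16" if "nu = 2 - 2 * lor b b'"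
      using ww that by (simp_all add: qs_def n2 lor_linear lor_commute)
  qed
  define k h where "k = lor rs n" and "h = lor r v5"
  have rsrs: "lor rs rs = (1 - 2 * k - nu / 4) / 4"
    using ww by (simp add: k_def rs_def nu_def lor_linear lor_commute field_simps)
  have "lor p ps = 1" "lor q qs = 1" "lor p n = 0" "lor r n = 0" "lor r rs = 1" "lor v5 n = 2"
    using dual by (simp_all add: lor_commute)
  \<comment> \<open>\<open>p\<close> has components only along \<open>ps\<close> and
    \<open>n\<close>, and \<open>n\<close> is orthogonal to \<open>ps\<close>; so \<open>P\<close>
    is the inverse of \<open>lor ps ps\<close>.\<close>
  have "P * (4 - nu) = 16" "Q * (4 - nu) = 16"
    using arg_cong[OF expand[of p], of "\<lambda>x. lor x ps"] arg_cong[OF expand[of q], of "\<lambda>x. lor x qs"]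
      \<open>lor p ps = 1\<close> \<open>lor q qs = 1\<close> orth pqr
    by (simp_all add: lor_linear lor_commute P_def[symmetric] Q_def[symmetric])
  then have h1: "R * (4 - nu) = - 4 * (4 + nu)"
  proof -
    have "R = 4 - P - Q" using PQR by simp
    then have "R * (4 - nu) = 4 * (4 - nu) - P * (4 - nu) - Q * (4 - nu)"
      by algebra
    then show ?thesis using \<open>P * (4 - nu) = 16\<close> \<open>Q * (4 - nu) = 16\<close> by simp
  qed
  have e2: "R * k + h * nu / 2 = 0"
    using arg_cong[OF expand[of r], of "\<lambda>x. lor x n"] \<open>lor r n = 0\<close> pqr
    by (simp add: lor_linear lor_commute R_def h_def k_def nu_def)
  have e3: "R * lor rs rs + h * k / 2 = 1"
    using arg_cong[OF expand[of r], of "\<lambda>x. lor x rs"] \<open>lor r rs = 1\<close> pqr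
    by (simp add: lor_linear lor_commute R_def h_def k_def)
  have e4: "h * k + nu / 2 = 2"
    using arg_cong[OF expand[of v5], of "\<lambda>x. lor x n"] \<open>lor v5 n = 2\<close> orth vv(5)
    by (simp add: lor_linear lor_commute h_def k_def nu_def)
  have "R * (1 - 2 * k - nu / 4) = 4 * (R * lor rs rs)" by (simp add: rsrs)
  also have "\<dots> = nu" using e3 e4 by (simp add: algebra_simps)
  finally have h2: "R * k = - (2 + nu)" using h1 by (simp add: algebra_simps)
  then have h3: "h * nu = 2 * (2 + nu)" using e2 by simp
  have "R * (h * k) = h * (R * k)" by simp
  moreover have "h * k = (4 - nu) / 2" using e4 by simp
  ultimately have "R * ((4 - nu) / 2) = h * - (2 + nu)" by (simp only: h2)
  then have "R * (4 - nu) = - 2 * (h * (2 + nu))" by (simp add: field_simps)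
  then have h4: "h * (2 + nu) = 2 * (4 + nu)" using h1 by simp
  \<comment> \<open>With \<open>h3\<close> and \<open>h4\<close> this reads
    \<open>(2 + nu) * (2 + nu) = nu * (4 + nu)\<close>, that is, 4 = 0.\<close>
  have "(h * nu) * (2 + nu) = nu * (h * (2 + nu))" by simp
  then show False unfolding h3 h4 by (simp add: algebra_simps)
qed

section \<open>Sign columns compatible with a linear relation\<close>

text \<open>The sign at the largest coefficient is normalised to 1. The ordering leaves at most four
  patterns unless four coefficients are equal and the last is 0; then exactly two of the first four
  signs are negative and the last is free.\<close>

lemma sign_solutions:
  fixes b0 b1 b2 b3 b4 :: real
  assumes sorted: "b0 \<ge> b1" "b1 \<ge> b2" "b2 \<ge> b3" "b3 \<ge> b4" "b4 \<ge> 0" "b2 > 0"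
    and T: "\<And>s1 s2 s3 s4. (s1, s2, s3, s4) \<in> T \<Longrightarrow>
      (s1 = 1 \<or> s1 = -1) \<and> (s2 = 1 \<or> s2 = -1) \<and> (s3 = 1 \<or> s3 = -1) \<and> (s4 = 1 \<or> s4 = -1) \<and>
      b0 + b1 * s1 + b2 * s2 + b3 * s3 + b4 * s4 = 0"
    and card: "card T = 5"
  shows "b0 = b1 \<and> b1 = b2 \<and> b2 = b3 \<and> b4 = 0 \<and>
    T \<subseteq> {(1,-1,-1,1), (1,-1,-1,-1), (-1,1,-1,1), (-1,1,-1,-1), (-1,-1,1,1), (-1,-1,1,-1)}"
proof -
  have no4: "\<not> T \<subseteq> {x, y, z, t}" for x y z t
  proof
    assume "T \<subseteq> {x, y, z, t}"
    then have "card T \<le> card {x, y, z, t}" by (intro card_mono) auto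
    also have "\<dots> \<le> 4" using card_length[of "[x, y, z, t]"] by simp
    finally show False using card by simp
  qed
  have sub: "T \<subseteq> X" if "\<And>s1 s2 s3 s4. (s1, s2, s3, s4) \<in> T \<Longrightarrow> (s1, s2, s3, s4) \<in> X" for X
    using that by auto
  have T': "((s1 = 1 \<and> b1 * s1 = b1) \<or> (s1 = -1 \<and> b1 * s1 = - b1)) \<and>
      ((s2 = 1 \<and> b2 * s2 = b2) \<or> (s2 = -1 \<and> b2 * s2 = - b2)) \<and>
      ((s3 = 1 \<and> b3 * s3 = b3) \<or> (s3 = -1 \<and> b3 * s3 = - b3)) \<and>
      ((s4 = 1 \<and> b4 * s4 = b4) \<or> (s4 = -1 \<and> b4 * s4 = - b4)) \<and>
      b0 + b1 * s1 + b2 * s2 + b3 * s3 + b4 * s4 = 0"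
    if "(s1, s2, s3, s4) \<in> T" for s1 s2 s3 s4
    using T[OF that] by auto
  consider "b4 > 0" | "b4 = 0" "b3 > 0" | "b4 = 0" "b3 = 0" using sorted by linarith
  then show ?thesis
  proof cases
    case 1
    \<comment> \<open>When all coefficients are positive, a solution has no plus sign, or one, or is
      \<open>(-1,-1,1,1)\<close>; the ordering makes every other sum positive.\<close>
    consider "(-1,-1,-1,-1) \<in> T" | "(-1,-1,1,1) \<in> T"
      | "(-1,-1,-1,-1) \<notin> T" "(-1,-1,1,1) \<notin> T" by blast
    then show ?thesis
    proof cases
      case c: 1
      have "b0 = b1 + b2 + b3 + b4" using T[OF c] by simp
      \<comment> \<open>The repetitions pad the list to the four entries of
        \<open>no4\<close>.\<close>
      have "T \<subseteq> {(-1,-1,-1,-1), (-1,-1,-1,-1), (-1,-1,-1,-1), (-1,-1,-1,-1)}"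
      proof (rule sub)
        fix s1 s2 s3 s4 assume x: "(s1, s2, s3, s4) \<in> T"
        show "(s1, s2, s3, s4) \<in> {(-1,-1,-1,-1), (-1,-1,-1,-1), (-1,-1,-1,-1), (-1,-1,-1,-1)}"
          using T'[OF x] \<open>b0 = b1 + b2 + b3 + b4\<close> 1 sorted
          by (elim conjE disjE; (linarith | (hypsubst, simp (no_asm); fail) | (hypsubst, erule notE[OF _ refl])))
      qed
      then show ?thesis by (rule no4[THEN notE])
    next
      case c: 2
      have "b0 + b3 + b4 = b1 + b2" using T[OF c] by simp
      have "T \<subseteq> {(-1,-1,1,1), (-1,1,-1,-1), (1,-1,-1,-1), (1,-1,-1,-1)}"
      proof (rule sub)
        fix s1 s2 s3 s4 assume x: "(s1, s2, s3, s4) \<in> T"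
        show "(s1, s2, s3, s4) \<in> {(-1,-1,1,1), (-1,1,-1,-1), (1,-1,-1,-1), (1,-1,-1,-1)}"
          using T'[OF x] \<open>b0 + b3 + b4 = b1 + b2\<close> 1 sorted
      by (elim conjE disjE; (linarith | (hypsubst, simp (no_asm); fail) | (hypsubst, erule notE[OF _ refl])))
      qed
      then show ?thesis by (rule no4[THEN notE])
    next
      case c: 3
      have "T \<subseteq> {(1,-1,-1,-1), (-1,1,-1,-1), (-1,-1,1,-1), (-1,-1,-1,1)}"
      proof (rule sub)
        fix s1 s2 s3 s4 assume x: "(s1, s2, s3, s4) \<in> T"
        have "(s1, s2, s3, s4) \<noteq> (-1,-1,-1,-1)" "(s1, s2, s3, s4) \<noteq> (-1,-1,1,1)" using c x by (metis, metis)
        then show "(s1, s2, s3, s4) \<in> {(1,-1,-1,-1), (-1,1,-1,-1), (-1,-1,1,-1), (-1,-1,-1,1)}"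
          using T'[OF x] 1 sorted
      by (elim conjE disjE; (linarith | (hypsubst, simp (no_asm); fail) | (hypsubst, erule notE[OF _ refl])))
      qed
      then show ?thesis by (rule no4[THEN notE])
    qed
  next
    case 2
    show ?thesis
    proof (cases "b0 = b1 \<and> b1 = b2 \<and> b2 = b3")
      case True
      have "T \<subseteq> {(1,-1,-1,1), (1,-1,-1,-1), (-1,1,-1,1), (-1,1,-1,-1), (-1,-1,1,1), (-1,-1,1,-1)}"
      proof (rule sub)
        fix s1 s2 s3 s4 assume x: "(s1, s2, s3, s4) \<in> T"
        show "(s1, s2, s3, s4) \<in>
            {(1,-1,-1,1), (1,-1,-1,-1), (-1,1,-1,1), (-1,1,-1,-1), (-1,-1,1,1), (-1,-1,1,-1)}"
          using T'[OF x] True 2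
      by (elim conjE disjE; (linarith | (hypsubst, simp (no_asm); fail) | (hypsubst, erule notE[OF _ refl])))
      qed
      with True \<open>b4 = 0\<close> show ?thesis by (intro conjI) (elim conjE, assumption)+
    next
      case False
      show ?thesis
      proof (cases "b0 = b1 + b2 + b3")
        case True
        have "T \<subseteq> {(-1,-1,-1,1), (-1,-1,-1,-1), (-1,-1,-1,-1), (-1,-1,-1,-1)}"
        proof (rule sub)
          fix s1 s2 s3 s4 assume x: "(s1, s2, s3, s4) \<in> T"
          show "(s1, s2, s3, s4) \<in> {(-1,-1,-1,1), (-1,-1,-1,-1), (-1,-1,-1,-1), (-1,-1,-1,-1)}"
            using T'[OF x] True 2 sorted
      by (elim conjE disjE; (linarith | (hypsubst, simp (no_asm); fail) | (hypsubst, erule notE[OF _ refl])))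
        qed
        then show ?thesis by (rule no4[THEN notE])
      next
        case n: False
        have f: "b0 + b1 > b2 + b3"
        proof (rule ccontr)
          assume "\<not> ?thesis"
          then have "b0 = b1" "b1 = b2" "b2 = b3" using sorted by linarith+
          then show False using False by blast
        qed
        have "T \<subseteq> {(-1,-1,1,1), (-1,-1,1,-1), (-1,1,-1,1), (-1,1,-1,-1)}"
        proof (rule sub)
          fix s1 s2 s3 s4 assume x: "(s1, s2, s3, s4) \<in> T"
          show "(s1, s2, s3, s4) \<in> {(-1,-1,1,1), (-1,-1,1,-1), (-1,1,-1,1), (-1,1,-1,-1)}"
            using T'[OF x] f n 2 sorted
      by (elim conjE disjE; (linarith | (hypsubst, simp (no_asm); fail) | (hypsubst, erule notE[OF _ refl])))
        qed
        then show ?thesis by (rule no4[THEN notE])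
      qed
    qed
  next
    case 3
    have "T \<subseteq> {(-1,-1,1,1), (-1,-1,1,-1), (-1,-1,-1,1), (-1,-1,-1,-1)}"
    proof (rule sub)
      fix s1 s2 s3 s4 assume x: "(s1, s2, s3, s4) \<in> T"
      show "(s1, s2, s3, s4) \<in> {(-1,-1,1,1), (-1,-1,1,-1), (-1,-1,-1,1), (-1,-1,-1,-1)}"
        using T'[OF x] 3 sorted
      by (elim conjE disjE; (linarith | (hypsubst, simp (no_asm); fail) | (hypsubst, erule notE[OF _ refl])))
    qed
    then show ?thesis by (rule no4[THEN notE])
  qed
qed

text \<open>The fifth sign of the third halving may be taken as 1: negating \<open>v5\<close> only
  swaps the members of the two complete pairs.\<close>

lemma five_of_six_impossible_aux:
  assumes span: "\<And>x. lor x v1 = 0 \<Longrightarrow> lor x v2 = 0 \<Longrightarrow> lor x v3 = 0 \<Longrightarrow> lor x v4 = 0 \<Longrightarrow>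
      lor x v5 = 0 \<Longrightarrow> x = 0"
    and sum0: "v1 + v2 + v3 + v4 = 0"
    and vv: "lor v1 v1 = 1" "lor v2 v2 = 1" "lor v3 v3 = 1" "lor v4 v4 = 1" "lor v5 v5 = 1"
    and a: "\<And>s. s = 1 \<or> s = -1 \<Longrightarrow> \<exists>y. lor y y = 1 \<and> lor y v1 = 1 \<and> lor y v2 = 1 \<and> lor y v3 = -1 \<and>
      lor y v4 = -1 \<and> lor y v5 = s"
    and b: "\<And>s. s = 1 \<or> s = -1 \<Longrightarrow> \<exists>y. lor y y = 1 \<and> lor y v1 = 1 \<and> lor y v2 = -1 \<and> lor y v3 = 1 \<and>
      lor y v4 = -1 \<and> lor y v5 = s"
    and c: "\<exists>y. lor y y = 1 \<and> lor y v1 = 1 \<and> lor y v2 = -1 \<and> lor y v3 = -1 \<and>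
      lor y v4 = 1 \<and> (lor y v5 = 1 \<or> lor y v5 = -1)"
  shows False
proof -
  obtain y where y: "lor y y = 1" "lor y v1 = 1" "lor y v2 = -1" "lor y v3 = -1" "lor y v4 = 1"
    "lor y v5 = 1 \<or> lor y v5 = -1" using c by blast
  define s where "s = lor y v5"
  have s: "s = 1 \<or> s = -1" using y(6) by (simp add: s_def)
  then have s': "- s = 1 \<or> - s = -1" by auto
  obtain a1 where a1: "lor a1 a1 = 1" "lor a1 v1 = 1" "lor a1 v2 = 1" "lor a1 v3 = -1" "lor a1 v4 = -1"
    "lor a1 v5 = s" using a[OF s] by blast
  obtain a2 where a2: "lor a2 a2 = 1" "lor a2 v1 = 1" "lor a2 v2 = 1" "lor a2 v3 = -1" "lor a2 v4 = -1"
    "lor a2 v5 = - s" using a[OF s'] by blast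
  obtain b1 where b1: "lor b1 b1 = 1" "lor b1 v1 = 1" "lor b1 v2 = -1" "lor b1 v3 = 1" "lor b1 v4 = -1"
    "lor b1 v5 = s" using b[OF s] by blast
  obtain b2 where b2: "lor b2 b2 = 1" "lor b2 v1 = 1" "lor b2 v2 = -1" "lor b2 v3 = 1" "lor b2 v4 = -1"
    "lor b2 v5 = - s" using b[OF s'] by blast
  have ss: "s * s = 1" using s by auto
  have sz: "s * t = 0 \<Longrightarrow> t = 0" for t using s by auto
  show False
  proof (rule exceptional_configuration_impossible[of v1 v2 v3 v4 "s *\<^sub>R v5" a1 a2 b1 b2 y])
    show "x = 0" if x: "lor x v1 = 0" "lor x v2 = 0" "lor x v3 = 0" "lor x v4 = 0" "lor x (s *\<^sub>R v5) = 0" for x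
    proof (rule span)
      show "lor x v5 = 0" using x(5) sz[of "lor x v5"] by (simp add: lor_scaleR_right)
    qed (fact x)+
  qed (simp_all add: sum0 vv a1 a2 b1 b2 y(1-5) lor_scaleR_left lor_scaleR_right ss flip: s_def)
qed

text \<open>The six columns form three pairs differing in the last sign, and \<open>m\<close> spoils
  one pair. Permuting \<open>u 1\<close>, \<open>u 2\<close>, \<open>u 3\<close> lets the spoilt
  pair play the part of the third halving, for which one column is enough.\<close>

lemma five_of_six_impossible:
  fixes u :: "nat \<Rightarrow> lvec" and m :: "real \<times> real \<times> real \<times> real"
  assumes span: "\<And>x. (\<And>i. i < 5 \<Longrightarrow> lor x (u i) = 0) \<Longrightarrow> x = 0"
    and sum0: "u 0 + u 1 + u 2 + u 3 = 0"
    and unit: "\<And>i. i < 5 \<Longrightarrow> lor (u i) (u i) = 1"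
    and m: "m \<in> {(1,-1,-1,1), (1,-1,-1,-1), (-1,1,-1,1), (-1,1,-1,-1), (-1,-1,1,1), (-1,-1,1,-1)}"
    and ex: "\<And>s1 s2 s3 s4. (s1, s2, s3, s4) \<in> {(1,-1,-1,1), (1,-1,-1,-1), (-1,1,-1,1), (-1,1,-1,-1),
      (-1,-1,1,1), (-1,-1,1,-1)} - {m} \<Longrightarrow> \<exists>y. lor y y = 1 \<and> lor y (u 0) = 1 \<and> lor y (u 1) = s1 \<and>
        lor y (u 2) = s2 \<and> lor y (u 3) = s3 \<and> lor y (u 4) = s4"
  shows False
proof -
  have span': "x = 0" if "lor x (u 0) = 0" "lor x (u 1) = 0" "lor x (u 2) = 0" "lor x (u 3) = 0" "lor x (u 4) = 0" for x
  proof (rule span)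
    fix i :: nat assume "i < 5"
    then have "i = 0 \<or> i = 1 \<or> i = 2 \<or> i = 3 \<or> i = 4" by linarith
    then show "lor x (u i) = 0" using that by blast
  qed
  have un: "lor (u 0) (u 0) = 1" "lor (u 1) (u 1) = 1" "lor (u 2) (u 2) = 1" "lor (u 3) (u 3) = 1"
    "lor (u 4) (u 4) = 1"
    using unit by simp_all
  have sums: "u 0 + u 1 + u 2 + u 3 = 0" "u 0 + u 1 + u 3 + u 2 = 0" "u 0 + u 3 + u 2 + u 1 = 0"
    using sum0 by (simp_all add: add_ac)
  consider "m = (1,-1,-1,1) \<or> m = (1,-1,-1,-1)" | "m = (-1,1,-1,1) \<or> m = (-1,1,-1,-1)"
    | "m = (-1,-1,1,1) \<or> m = (-1,-1,1,-1)"
    using m by blast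
  then show False
  proof cases
    case 1
    have A: "\<exists>y. lor y y = 1 \<and> lor y (u 0) = 1 \<and> lor y (u 1) = -1 \<and> lor y (u 2) = -1 \<and> lor y (u 3) = 1 \<and> lor y (u 4) = s"
      "\<exists>y. lor y y = 1 \<and> lor y (u 0) = 1 \<and> lor y (u 1) = -1 \<and> lor y (u 2) = 1 \<and> lor y (u 3) = -1 \<and> lor y (u 4) = s"
      if "s = 1 \<or> s = -1" for s
      by ((rule ex), (use that 1 in auto)[1])+
    \<comment> \<open>The surviving member of the spoilt pair.\<close>
    obtain r where r: "r = 1 \<or> r = -1" "(1,-1,-1,r) \<in> {(1,-1,-1,1), (1,-1,-1,-1), (-1,1,-1,1), (-1,1,-1,-1),
      (-1,-1,1,1), (-1,-1,1,-1)} - {m}"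
    proof (cases "m = (1,-1,-1,1)")
      case True
      then show ?thesis by (intro that[of "-1"]) simp_all
    next
      case False
      then show ?thesis by (intro that[of 1]) simp_all
    qed
    have C: "\<exists>y. lor y y = 1 \<and> lor y (u 0) = 1 \<and> lor y (u 1) = 1 \<and> lor y (u 2) = -1 \<and> lor y (u 3) = -1 \<and>
        (lor y (u 4) = 1 \<or> lor y (u 4) = -1)"
      using ex[OF r(2)] r(1) by blast
    show False
      by (rule five_of_six_impossible_aux[of "u 0" "u 3" "u 2" "u 1" "u 4"])
        (fact un sums | use span' in blast | use A C in blast)+
  next
    case 2
    have A: "\<exists>y. lor y y = 1 \<and> lor y (u 0) = 1 \<and> lor y (u 1) = 1 \<and> lor y (u 2) = -1 \<and> lor y (u 3) = -1 \<and> lor y (u 4) = s"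
      "\<exists>y. lor y y = 1 \<and> lor y (u 0) = 1 \<and> lor y (u 1) = -1 \<and> lor y (u 2) = -1 \<and> lor y (u 3) = 1 \<and> lor y (u 4) = s"
      if "s = 1 \<or> s = -1" for s
      by ((rule ex), (use that 2 in auto)[1])+
    obtain r where r: "r = 1 \<or> r = -1" "(-1,1,-1,r) \<in> {(1,-1,-1,1), (1,-1,-1,-1), (-1,1,-1,1), (-1,1,-1,-1),
      (-1,-1,1,1), (-1,-1,1,-1)} - {m}"
    proof (cases "m = (-1,1,-1,1)")
      case True
      then show ?thesis by (intro that[of "-1"]) simp_all
    next
      case False
      then show ?thesis by (intro that[of 1]) simp_all
    qed
    have C: "\<exists>y. lor y y = 1 \<and> lor y (u 0) = 1 \<and> lor y (u 1) = -1 \<and> lor y (u 2) = 1 \<and> lor y (u 3) = -1 \<and>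
        (lor y (u 4) = 1 \<or> lor y (u 4) = -1)"
      using ex[OF r(2)] r(1) by blast
    show False
      by (rule five_of_six_impossible_aux[of "u 0" "u 1" "u 3" "u 2" "u 4"])
        (fact un sums | use span' in blast | use A C in blast)+
  next
    case 3
    have A: "\<exists>y. lor y y = 1 \<and> lor y (u 0) = 1 \<and> lor y (u 1) = 1 \<and> lor y (u 2) = -1 \<and> lor y (u 3) = -1 \<and> lor y (u 4) = s"
      "\<exists>y. lor y y = 1 \<and> lor y (u 0) = 1 \<and> lor y (u 1) = -1 \<and> lor y (u 2) = 1 \<and> lor y (u 3) = -1 \<and> lor y (u 4) = s"
      if "s = 1 \<or> s = -1" for s
      by ((rule ex), (use that 3 in auto)[1])+
    obtain r where r: "r = 1 \<or> r = -1" "(-1,-1,1,r) \<in> {(1,-1,-1,1), (1,-1,-1,-1), (-1,1,-1,1), (-1,1,-1,-1),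
      (-1,-1,1,1), (-1,-1,1,-1)} - {m}"
    proof (cases "m = (-1,-1,1,1)")
      case True
      then show ?thesis by (intro that[of "-1"]) simp_all
    next
      case False
      then show ?thesis by (intro that[of 1]) simp_all
    qed
    have C: "\<exists>y. lor y y = 1 \<and> lor y (u 0) = 1 \<and> lor y (u 1) = -1 \<and> lor y (u 2) = -1 \<and> lor y (u 3) = 1 \<and>
        (lor y (u 4) = 1 \<or> lor y (u 4) = -1)"
      using ex[OF r(2)] r(1) by blast
    show False
      by (rule five_of_six_impossible_aux[of "u 0" "u 1" "u 2" "u 3" "u 4"])
        (fact un sums | use span' in blast | use A C in blast)+
  qed
qed

context tangent_families
begin

lemma complement_nonzero: "\<exists>x. x \<noteq> 0 \<and> (\<forall>i<5. lor x (v i) = 0)"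
proof (rule ccontr)
  assume "\<not> ?thesis"
  then have perp0: "x = 0" if "\<And>i. i < 5 \<Longrightarrow> lor x (v i) = 0" for x using that by blast
  have w_unit: "lor (w j) (w j) = 1" if "j < 5" for j
  proof (rule ccontr)
    assume "lor (w j) (w j) \<noteq> 1"
    then have "lor (w j) (w j) = 0" using w_unit_or_null[OF that] by blast
    then have "w j = 0" using perp0[of "w j"] null_w_orthogonal[OF _ that] by (simp add: lor_commute)
    then show False using w_nonzero[OF that] by blast
  qed
  obtain a i0 where i0: "i0 < 5" "a i0 \<noteq> 0" and rel: "(\<Sum>i<5. a i *\<^sub>R v i) = 0"
    by (rule five_vectors_dependent)
  \<comment> \<open>Sorting by absolute value and absorbing the signs into \<open>u\<close> brings
    the relation into the shape of \<open>sign_solutions\<close>.\<close>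
  define xs where "xs = sort_key (\<lambda>i. - \<bar>a i\<bar>) [0..<5]"
  have xs: "set xs = {..<5}" "length xs = 5" "distinct xs" "sorted (map (\<lambda>i. - \<bar>a i\<bar>) xs)"
  proof -
    have "set xs = set [0..<5]" unfolding xs_def by (rule set_sort)
    then show "set xs = {..<5}" by (simp only: set_upt atLeast0LessThan)
    have "length xs = length [0..<5]" unfolding xs_def by (rule length_sort)
    then show "length xs = 5" by (simp only: length_upt)
    show "distinct xs" unfolding xs_def by (simp only: distinct_sort distinct_upt)
    show "sorted (map (\<lambda>i. - \<bar>a i\<bar>) xs)" unfolding xs_def by (rule sorted_sort_key)
  qed
  have bij: "bij_betw ((!) xs) {..<5} {..<5}"
    by (rule bij_betw_nth) (simp_all only: xs(1-3))
  have xs_less: "xs ! i < 5" if "i < 5" for i using that xs(1,2) nth_mem[of i xs] by auto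
  have xs_ne: "xs ! i \<noteq> xs ! j" if "i < 5" "j < 5" "i \<noteq> j" for i j
    using that xs(2,3) by (simp add: nth_eq_iff_index_eq)
  define b where "b i = \<bar>a (xs ! i)\<bar>" for i
  define sg where "sg i = (if a (xs ! i) < 0 then - 1 else 1 :: real)" for i
  define u where "u i = sg i *\<^sub>R v (xs ! i)" for i
  have b_mono: "b j \<le> b i" if "i \<le> j" "j < 5" for i j
    using sorted_nth_mono[OF xs(4), of i j] that xs(2) by (simp add: b_def)
  have u_unit: "lor (u i) (u i) = 1" if "i < 5" for i
    using v_unit[OF xs_less[OF that]] by (simp add: u_def sg_def lor_linear)
  have u_indep: "u i \<noteq> t *\<^sub>R u j" if "i < 5" "j < 5" "i \<noteq> j" for i j t
  proof
    assume "u i = t *\<^sub>R u j"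
    then have "v (xs ! i) = (sg i * t * sg j) *\<^sub>R v (xs ! j)"
      by (auto simp: u_def sg_def split: if_splits) (metis minus_minus)+
    then show False using v_not_scaled[OF xs_less[OF that(1)] xs_less[OF that(2)] xs_ne[OF that]] by blast
  qed
  have u_sign: "lor (u i) (w j) = 1 \<or> lor (u i) (w j) = -1" if "i < 5" "j < 5" for i j
    using unit_w_sign[OF xs_less[OF that(1)] that(2) w_unit[OF that(2)]]
    by (auto simp: u_def sg_def lor_linear)
  have u_perp0: "x = 0" if x: "\<And>i. i < 5 \<Longrightarrow> lor x (u i) = 0" for x
  proof (rule perp0)
    fix i :: nat assume "i < 5"
    then obtain j where "j < 5" "i = xs ! j" using xs(1,2) by (metis in_set_conv_nth lessThan_iff)
    then show "lor x (v i) = 0" using x[of j] by (simp add: u_def sg_def lor_linear split: if_splits)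
  qed
  have "(\<Sum>i<5. b i *\<^sub>R u i) = (\<Sum>i<5. a (xs ! i) *\<^sub>R v (xs ! i))"
    by (intro sum.cong refl) (simp add: b_def u_def sg_def)
  also have "\<dots> = 0" using sum.reindex_bij_betw[OF bij, of "\<lambda>i. a i *\<^sub>R v i"] rel by simp
  finally have rel': "b 0 *\<^sub>R u 0 + b 1 *\<^sub>R u 1 + b 2 *\<^sub>R u 2 + b 3 *\<^sub>R u 3 + b 4 *\<^sub>R u 4 = 0"
    by (simp add: eval_nat_numeral)
  have b_nonneg: "b i \<ge> 0" for i by (simp add: b_def)
  have b0: "b 0 > 0"
  proof -
    obtain j where j: "j < 5" "i0 = xs ! j" using xs(1,2) i0(1) by (metis in_set_conv_nth lessThan_iff)
    then have "b j > 0" using i0 by (simp add: b_def)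
    then show ?thesis using b_mono[of 0 j] j by simp
  qed
  \<comment> \<open>Otherwise at most two vectors enter the relation, which makes them
    proportional.\<close>
  have b2: "b 2 > 0"
  proof (rule ccontr)
    assume "\<not> ?thesis"
    then have "b 2 = 0" "b 3 = 0" "b 4 = 0"
      using b_nonneg[of 2] b_nonneg[of 3] b_nonneg[of 4] b_mono[of 2 3] b_mono[of 2 4] by auto
    then have "b 0 *\<^sub>R u 0 = (- b 1) *\<^sub>R u 1" using rel' by (simp add: add_eq_0_iff2)
    then have "u 0 = (inverse (b 0) * (- b 1)) *\<^sub>R u 1"
      using b0 by (metis less_irrefl left_inverse scaleR_one scaleR_scaleR)
    then show False using u_indep[of 0 1 "inverse (b 0) * (- b 1)"] by simp
  qed
  \<comment> \<open>The sign of each \<open>w j\<close> is chosen so that its column starts with 1;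
    full span then makes the other four signs determine it.\<close>
  define x where "x j = lor (u 0) (w j) *\<^sub>R w j" for j
  have x_unit: "lor (x j) (x j) = 1" and x0: "lor (u 0) (x j) = 1" if "j < 5" for j
    using u_sign[of 0 j] w_unit[OF that] that by (auto simp: x_def lor_linear)
  have x_sign: "lor (u i) (x j) = 1 \<or> lor (u i) (x j) = -1" if "i < 5" "j < 5" for i j
    using u_sign[OF that] u_sign[of 0 j] that by (auto simp: x_def lor_linear)
  define \<tau> where "\<tau> j = (lor (u 1) (x j), lor (u 2) (x j), lor (u 3) (x j), lor (u 4) (x j))" for j
  have "inj_on \<tau> {..<5}"
  proof (rule inj_onI)
    fix j k assume jk: "j \<in> {..<5}" "k \<in> {..<5}" "\<tau> j = \<tau> k"
    have "x j - x k = 0"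
    proof (rule u_perp0)
      fix i :: nat assume "i < 5"
      then have "i = 0 \<or> i = 1 \<or> i = 2 \<or> i = 3 \<or> i = 4" by linarith
      then show "lor (x j - x k) (u i) = 0"
        using jk x0[of j] x0[of k] by (auto simp: \<tau>_def lor_linear lor_commute)
    qed
    then have "w j = (lor (u 0) (w j) * lor (u 0) (w k)) *\<^sub>R w k"
      using u_sign[of 0 j] u_sign[of 0 k] jk by (auto simp: x_def) (metis minus_minus)+
    then show "j = k" using w_distinct[of j k] jk by auto
  qed
  then have card: "card (\<tau> ` {..<5}) = 5" by (simp add: card_image)
  have T: "(s1 = 1 \<or> s1 = -1) \<and> (s2 = 1 \<or> s2 = -1) \<and> (s3 = 1 \<or> s3 = -1) \<and> (s4 = 1 \<or> s4 = -1) \<and>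
      b 0 + b 1 * s1 + b 2 * s2 + b 3 * s3 + b 4 * s4 = 0"
    if s: "(s1, s2, s3, s4) \<in> \<tau> ` {..<5}" for s1 s2 s3 s4
  proof -
    obtain j where j: "j < 5" "(s1, s2, s3, s4) = \<tau> j" using s by auto
    have "lor (b 0 *\<^sub>R u 0 + b 1 *\<^sub>R u 1 + b 2 *\<^sub>R u 2 + b 3 *\<^sub>R u 3 + b 4 *\<^sub>R u 4) (x j) = 0"
      by (simp only: rel' lor_zero_left)
    then have "b 0 + b 1 * s1 + b 2 * s2 + b 3 * s3 + b 4 * s4 = 0"
      using j x0[OF j(1)] by (simp add: lor_linear \<tau>_def)
    then show ?thesis
      using x_sign[of 1 j] x_sign[of 2 j] x_sign[of 3 j] x_sign[of 4 j] j by (simp add: \<tau>_def)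
  qed
  let ?S = "{(1,-1,-1,1), (1,-1,-1,-1), (-1,1,-1,1), (-1,1,-1,-1), (-1,-1,1,1), (-1,-1,1,-1)}
    :: (real \<times> real \<times> real \<times> real) set"
  \<comment> \<open>The instances below start with \<open>b 1\<close> because
    \<open>b0 \<ge> b1\<close> stands for \<open>b1 \<le> b0\<close>, where \<open>b1\<close> occurs
    first.\<close>
  have beq: "b 0 = b 1" "b 1 = b 2" "b 2 = b 3" "b 4 = 0" and sub: "\<tau> ` {..<5} \<subseteq> ?S"
    using sign_solutions[of "b 1" "b 0" "b 2" "b 3" "b 4" "\<tau> ` {..<5}", OF _ _ _ _ _ b2 T card]
      b_mono[of 0 1] b_mono[of 1 2] b_mono[of 2 3] b_mono[of 3 4] b_nonneg[of 4] by simp_all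
  have "b 0 *\<^sub>R (u 0 + u 1 + u 2 + u 3) = 0"
    using rel' beq by (simp add: scaleR_add_right)
  then have sum0: "u 0 + u 1 + u 2 + u 3 = 0" using b0 by simp
  have "card ?S = 6" by (simp add: card_insert_if)
  then have "card (?S - \<tau> ` {..<5}) = 1" using card sub by (simp add: card_Diff_subset)
  then obtain m where m: "?S - \<tau> ` {..<5} = {m}" by (auto simp: card_1_singleton_iff)
  show False
  proof (rule five_of_six_impossible[OF u_perp0 sum0 u_unit])
    show "m \<in> ?S" using m by blast
    fix s1 s2 s3 s4 assume "(s1, s2, s3, s4) \<in> ?S - {m}"
    then have "(s1, s2, s3, s4) \<in> \<tau> ` {..<5}" using m by blast
    then obtain j where j: "j < 5" "(s1, s2, s3, s4) = \<tau> j" by auto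
    then show "\<exists>y. lor y y = 1 \<and> lor y (u 0) = 1 \<and> lor y (u 1) = s1 \<and>
        lor y (u 2) = s2 \<and> lor y (u 3) = s3 \<and> lor y (u 4) = s4"
      using x_unit x0 by (intro exI[of _ "x j"]) (simp add: \<tau>_def lor_commute)
  qed
qed

lemma pencil: "\<exists>n u. pencil_frame n u \<and> (\<forall>i<5. v i \<in> span {n, u})"
proof -
  obtain n where n: "n \<noteq> 0" "\<And>i. i < 5 \<Longrightarrow> lor n (v i) = 0" using complement_nonzero by blast
  show ?thesis
  proof (cases "\<forall>x. (\<forall>i<5. lor x (v i) = 0) \<longrightarrow> (\<exists>t. x = t *\<^sub>R n)")
    case True
    then show ?thesis using pencil_if_complement_one[OF n] by blast
  next
    case False
    then obtain n' where n': "\<And>i. i < 5 \<Longrightarrow> lor n' (v i) = 0" "\<And>t. n' \<noteq> t *\<^sub>R n" by blast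
    show ?thesis
    proof (rule pencil_if_complement_ge_two[OF n(2) n'(1)])
      fix a b assume ab: "a *\<^sub>R n + b *\<^sub>R n' = 0"
      have "b = 0"
      proof (rule ccontr)
        assume "b \<noteq> 0"
        moreover have "b *\<^sub>R n' = (- a) *\<^sub>R n" using ab by (simp add: add_eq_0_iff)
        ultimately have "n' = inverse b *\<^sub>R ((- a) *\<^sub>R n)"
          by (metis left_inverse scaleR_one scaleR_scaleR)
        then show False using n'(2)[of "inverse b * - a"] by simp
      qed
      then show "a = 0 \<and> b = 0" using ab n(1) by simp
    qed
  qed
qed

end

section \<open>Generalized circles as vectors\<close>

text \<open>The lift of the plane to the light cone: on finite points \<open>lor\<close> becomes
  minus half the squared distance, and infinity is the limiting direction of the lifted
  paraboloid.\<close>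

definition pt :: "ext_plane \<Rightarrow> lvec" where
  "pt P = (case P of None \<Rightarrow> (0, 0, 1) | Some z \<Rightarrow> (z, 1, (norm z)\<^sup>2 / 2))"

definition zeros :: "lvec \<Rightarrow> ext_plane set" where
  "zeros v = {P. lor v (pt P) = 0}"

lemma lor_pt_pt [simp]: "lor (pt P) (pt P) = 0"
  by (cases P) (simp_all add: lor_def pt_def power2_norm_eq_inner)

lemma pt_nonzero [simp]: "pt P \<noteq> 0"
  by (cases P) (simp_all add: pt_def zero_prod_def)

lemma pt_collinear: "pt P = t *\<^sub>R pt Q \<Longrightarrow> P = Q"
  by (cases P; cases Q) (auto simp: pt_def)

lemma lor_pt_eq_0_iff: "lor (pt P) (pt Q) = 0 \<longleftrightarrow> P = Q"
  using null_orthogonal_imp_collinear[of "pt P" "pt Q"] pt_collinear by auto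

lemma null_vector_is_pt:
  assumes "lor n n = 0" "n \<noteq> 0"
  obtains P t where "t \<noteq> 0" "n = t *\<^sub>R pt P"
proof -
  obtain c a d where n: "n = (c, a, d)" by (cases n)
  have cc: "c \<bullet> c = 2 * (a * d)" using assms(1) by (simp add: lor_def n)
  show ?thesis
  proof (cases "a = 0")
    case True
    then have "c = 0" using cc by simp
    then show ?thesis using that[of d None] assms(2) True n by (auto simp: pt_def zero_prod_def)
  next
    case False
    have "(norm c)\<^sup>2 = 2 * (a * d)" using cc by (simp add: dot_square_norm)
    then have "n = a *\<^sub>R pt (Some ((1 / a) *\<^sub>R c))"
      using False by (simp add: n pt_def power_divide power2_eq_square[of a])
    then show ?thesis using that False by blast
  qed
qed

lemma zeros_pt: "zeros (pt P) = {P}"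
  by (auto simp: zeros_def lor_pt_eq_0_iff)

lemma zeros_scaleR: "t \<noteq> 0 \<Longrightarrow> zeros (t *\<^sub>R v) = zeros v"
  by (simp add: zeros_def lor_scaleR_left)

lemma sphere_zeros:
  assumes "r > 0"
  shows "\<exists>v. lor v v = 1 \<and> Some ` sphere c r = zeros v"
proof -
  \<comment> \<open>The squared equation of the circle is linear in the lift of \<open>z\<close>;
    its coefficient vector is divided by \<open>r\<close> to get norm 1.\<close>
  let ?v = "((1 / r) *\<^sub>R c, 1 / r, ((norm c)\<^sup>2 - r\<^sup>2) / (2 * r)) :: lvec"
  have "lor ?v ?v = 1"
    using assms by (simp add: lor_def dot_square_norm field_simps power2_eq_square)
  moreover have S: "Some z \<in> zeros ?v \<longleftrightarrow> z \<in> sphere c r" for z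
  proof -
    have N: "(norm (z - c))\<^sup>2 = (norm z)\<^sup>2 - 2 * (c \<bullet> z) + (norm c)\<^sup>2"
      by (simp add: power2_norm_eq_inner inner_diff_left inner_diff_right inner_commute)
    have "lor ?v (pt (Some z)) = (r\<^sup>2 - (norm (z - c))\<^sup>2) / (2 * r)"
      unfolding N using assms by (simp add: lor_def pt_def field_simps)
    then have "Some z \<in> zeros ?v \<longleftrightarrow> r\<^sup>2 = (norm (z - c))\<^sup>2"
      using assms by (simp add: zeros_def)
    also have "\<dots> \<longleftrightarrow> norm (z - c) = r" using assms by (auto simp: power2_eq_iff_nonneg)
    finally show ?thesis by (simp add: dist_norm norm_minus_commute)
  qed
  moreover have "None \<notin> zeros ?v" using assms by (simp add: zeros_def pt_def lor_def)
  then have "P \<in> Some ` sphere c r \<longleftrightarrow> P \<in> zeros ?v" for P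
    using S by (cases P) (auto simp del: mem_sphere)
  ultimately show ?thesis by blast
qed

lemma straight_line_zeros:
  assumes "straight_line L"
  shows "\<exists>v. lor v v = 1 \<and> ext_line L = zeros v"
proof -
  have "affine hull L = L" using assms by (simp add: straight_line_def affine_hull_eq)
  moreover have "\<exists>a b. a \<noteq> 0 \<and> affine hull L = {x. a \<bullet> x = b}"
    using assms aff_dim_eq_hyperplane[of L] by (simp add: straight_line_def)
  ultimately obtain a b where ab: "a \<noteq> 0" "L = {x. a \<bullet> x = b}" by metis
  let ?v = "((1 / norm a) *\<^sub>R a, 0, b / norm a) :: lvec"
  have "lor ?v ?v = 1" using ab(1) by (simp add: lor_def field_simps flip: power2_norm_eq_inner power2_eq_square)
  moreover have "ext_line L = zeros ?v"
  proof (rule set_eqI)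
    show "P \<in> ext_line L \<longleftrightarrow> P \<in> zeros ?v" for P
      using ab by (cases P) (auto simp: ext_line_def zeros_def lor_def pt_def field_simps)
  qed
  ultimately show ?thesis by blast
qed

text \<open>Circles and lines are normalised to unit vectors, which leaves a sign open; points keep
  an arbitrary nonzero scale.\<close>

definition represents :: "lvec \<Rightarrow> ext_plane set \<Rightarrow> bool" where
  "represents v C \<longleftrightarrow> C = zeros v \<and> v \<noteq> 0 \<and>
    ((is_circle C \<or> is_line C) \<and> lor v v = 1 \<or> is_point C \<and> lor v v = 0)"

lemma gen_circle_represents: "gen_circle C \<Longrightarrow> \<exists>v. represents v C"
  unfolding gen_circle_def
proof (elim disjE)
  assume C: "is_circle C"
  then obtain v where "lor v v = 1" "C = zeros v"
    unfolding is_circle_def using sphere_zeros by metis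
  then show ?thesis using C by (intro exI[of _ v]) (auto simp: represents_def)
next
  assume C: "is_line C"
  then obtain v where "lor v v = 1" "C = zeros v"
    unfolding is_line_def using straight_line_zeros by metis
  then show ?thesis using C by (intro exI[of _ v]) (auto simp: represents_def)
next
  assume C: "is_point C"
  then obtain P where "C = {P}" by (auto simp: is_point_def)
  then show ?thesis using C by (intro exI[of _ "pt P"]) (auto simp: represents_def zeros_pt)
qed

lemma circle_not_point: "is_circle C \<Longrightarrow> \<not> is_point C"
proof
  assume "is_circle C" "is_point C"
  then obtain c :: complex and r P where r: "r > 0" and e: "Some ` sphere c r = {P}"
    unfolding is_circle_def is_point_def by metis
  have "c + of_real r \<in> sphere c r" "c - of_real r \<in> sphere c r" using r by (simp_all add: dist_norm)
  then have "Some (c + of_real r) = P" "Some (c - of_real r) = P" using e by blast+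
  then have "c + of_real r = c - of_real r" by auto
  then have "complex_of_real (2 * r) = 0" by (simp add: algebra_simps)
  then show False using r by (simp del: of_real_mult)
qed

lemma line_not_point: "is_line C \<Longrightarrow> \<not> is_point C"
proof
  assume "is_line C" "is_point C"
  then obtain L P where L: "straight_line L" "ext_line L = {P}"
    by (auto simp: is_line_def is_point_def)
  then have "L \<noteq> {}" by (auto simp: straight_line_def)
  then obtain x where "x \<in> L" by blast
  then have "Some x = P" "None = P" using L(2) by (auto simp: ext_line_def)
  then show False by simp
qed

lemma represents_unit: "represents v C \<Longrightarrow> is_circle C \<or> is_line C \<Longrightarrow> lor v v = 1"
  using circle_not_point line_not_point by (auto simp: represents_def)

lemma represents_distinct:
  assumes "represents v C" "represents w D" "C \<noteq> D"
  shows "v \<noteq> t *\<^sub>R w"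
proof
  assume "v = t *\<^sub>R w"
  moreover from this have "t \<noteq> 0" using assms(1) by (auto simp: represents_def)
  ultimately show False using assms by (simp add: represents_def zeros_scaleR)
qed

text \<open>If \<open>v\<close> and \<open>w\<close> span a nondegenerate plane, its orthogonal complement is a nondegenerate plane
  as well, so together with the null line of \<open>P\<close> it contains a second one.\<close>
lemma single_common_zero:
  assumes v: "lor v v = 1" and w: "lor w w = 1" and P: "zeros v \<inter> zeros w = {P}"
  shows "(lor v w)\<^sup>2 = 1"
proof (rule ccontr)
  assume ne: "(lor v w)\<^sup>2 \<noteq> 1"
  define \<beta> where "\<beta> = lor v w"
  define D where "D = 1 - \<beta>\<^sup>2"
  have D: "D \<noteq> 0" using ne by (simp add: D_def \<beta>_def)
  define x where "x = pt P"
  have x: "lor x x = 0" "lor x v = 0" "lor x w = 0"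
    using P by (auto simp: zeros_def x_def lor_commute)
  \<comment> \<open>Any vector not orthogonal to \<open>x\<close> would do. The coefficients
    \<open>a\<close>, \<open>b\<close> solve the Gram system of \<open>v\<close>, \<open>w\<close>
    with determinant \<open>D\<close>, so that \<open>y1\<close> lies in the complement.\<close>
  define y where "y = flat x"
  have xy: "lor x y \<noteq> 0" by (simp add: y_def lor_flat x_def)
  define a b where "a = (lor y v - \<beta> * lor y w) / D" and "b = (lor y w - \<beta> * lor y v) / D"
  define y1 where "y1 = y - a *\<^sub>R v - b *\<^sub>R w"
  have "a * D = lor y v - \<beta> * lor y w" "b * D = lor y w - \<beta> * lor y v"
    using D by (simp_all add: a_def b_def)
  then have "(a + \<beta> * b) * D = lor y v * D" "(\<beta> * a + b) * D = lor y w * D"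
    unfolding D_def by algebra+
  then have ab: "a + \<beta> * b = lor y v" "\<beta> * a + b = lor y w"
    using D by simp_all
  have y1: "lor y1 v = 0" "lor y1 w = 0" "lor x y1 = lor x y"
    using ab v w x by (simp_all add: y1_def lor_linear \<beta>_def lor_commute algebra_simps)
  \<comment> \<open>This multiple of \<open>x\<close> makes the vector null and keeps its product
    with \<open>x\<close> nonzero, so its point differs from \<open>P\<close>.\<close>
  define y2 where "y2 = y1 - (lor y1 y1 / (2 * lor x y)) *\<^sub>R x"
  have y2: "lor y2 v = 0" "lor y2 w = 0" "lor x y2 \<noteq> 0" "lor y2 y2 = 0"
    using y1 x xy by (simp_all add: y2_def lor_linear lor_commute)
  then have "y2 \<noteq> 0" by auto
  then obtain Q t where t: "t \<noteq> 0" "y2 = t *\<^sub>R pt Q" using null_vector_is_pt y2(4) by blast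
  have "Q \<in> zeros v \<inter> zeros w" using y2(1,2) t by (simp add: zeros_def lor_linear lor_commute)
  then have "Q = P" using P by blast
  then show False using y2(3) t by (simp add: x_def lor_linear)
qed

lemma represents_point:
  assumes "represents v {P}"
  obtains t where "t \<noteq> 0" "v = t *\<^sub>R pt P"
proof -
  have "is_point {P}" by (simp add: is_point_def)
  then have v: "lor v v = 0" "v \<noteq> 0" "zeros v = {P}"
    using assms circle_not_point line_not_point by (auto simp: represents_def)
  then obtain Q t where "t \<noteq> 0" "v = t *\<^sub>R pt Q" using null_vector_is_pt by blast
  moreover from this have "Q = P" using v(3) by (simp add: zeros_scaleR zeros_pt)
  ultimately show ?thesis using that by blast
qed

lemma parallel_lines_meet_at_infinity:
  assumes "straight_line L" "affine_parallel L M" "L \<noteq> M"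
  shows "ext_line L \<inter> ext_line M = {None}"
proof -
  have aff: "affine L" using assms(1) by (simp add: straight_line_def)
  obtain a where M: "M = (\<lambda>x. a + x) ` L" using assms(2) by (auto simp: affine_parallel_def)
  have "L \<inter> M = {}"
  proof (rule ccontr)
    assume "L \<inter> M \<noteq> {}"
    then obtain y where y: "y \<in> L" "a + y \<in> L" using M by auto
    \<comment> \<open>A common point makes \<open>a\<close> a direction of \<open>L\<close>, so
      translation by \<open>a\<close> preserves \<open>L\<close>.\<close>
    have "a + x \<in> L" if "x \<in> L" for x
      using mem_affine_3_minus[OF aff that y(2,1), of 1] by (simp add: algebra_simps)
    moreover have "x \<in> M" if "x \<in> L" for x
      using mem_affine_3_minus[OF aff that y(1,2), of 1] M by (auto simp: algebra_simps image_iff intro!: bexI[of _ "x - a"])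
    ultimately show False using M assms(3) by blast
  qed
  then show ?thesis by (auto simp: ext_line_def)
qed

text \<open>Circles and lines, parallel lines included, reduce to a single common point; with a
  point on one side both sides of the equation are 0. The second clause records that two points are
  never tangent.\<close>

lemma tangent_imp_lor:
  assumes v: "represents v C" and w: "represents w D" and "tangent C D"
  shows "(lor v w)\<^sup>2 = lor v v * lor w w \<and> (lor v v = 1 \<or> lor w w = 1)"
proof -
  have Z: "C = zeros v" "D = zeros w" using v w by (simp_all add: represents_def)
  have single: ?thesis if "is_circle C \<or> is_line C" "is_circle D \<or> is_line D" "C \<inter> D = {P}" for P
    using represents_unit[OF v that(1)] represents_unit[OF w that(2)] single_common_zero[of v w P] that(3)
    by (simp add: Z)
  obtain P where "tangent_at P C D" using assms(3) by (auto simp: tangent_def)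
  then show ?thesis
  proof cases
    case circle_circle
    then show ?thesis using single[of P] by blast
  next
    case circle_line
    then show ?thesis using single[of P] by blast
  next
    case line_circle
    then show ?thesis using single[of P] by blast
  next
    case (parallel_lines L M)
    then have "C \<inter> D = {None}" using parallel_lines_meet_at_infinity by simp
    moreover have "is_line C" "is_line D" using parallel_lines by (auto simp: is_line_def)
    ultimately show ?thesis using single[of None] by blast
  next
    case point_left
    then obtain t where "v = t *\<^sub>R pt P" using v represents_point by metis
    then show ?thesis using point_left represents_unit[OF w] by (simp add: Z zeros_def lor_linear lor_commute)
  next
    case point_right
    then obtain t where "w = t *\<^sub>R pt P" using w represents_point by metis
    then show ?thesis using point_right represents_unit[OF v] by (simp add: Z zeros_def lor_linear lor_commute)
  qed
qed

section \<open>From a pencil back to tangency at its point\<close>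

lemma affine_parallel_same_normal:
  fixes c :: complex
  assumes "c \<bullet> c = 1"
  shows "affine_parallel {z. c \<bullet> z = k} {z. c \<bullet> z = k'}"
proof -
  have "{z. c \<bullet> z = k'} = (\<lambda>x. (k' - k) *\<^sub>R c + x) ` {z. c \<bullet> z = k}"
  proof (intro set_eqI iffI)
    fix z assume "z \<in> {z. c \<bullet> z = k'}"
    then show "z \<in> (\<lambda>x. (k' - k) *\<^sub>R c + x) ` {z. c \<bullet> z = k}"
      using assms by (intro image_eqI[of _ _ "z - (k' - k) *\<^sub>R c"]) (auto simp: inner_diff_right)
  qed (use assms in \<open>auto simp: inner_add_right\<close>)
  then show ?thesis unfolding affine_parallel_def by blast
qed

lemma span_frame_E:
  assumes "x \<in> span {n, u :: lvec}"
  shows "\<exists>a b. x = a *\<^sub>R n + b *\<^sub>R u"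
proof -
  obtain a b where "x - a *\<^sub>R n = b *\<^sub>R u"
    using assms by (auto simp: span_insert span_singleton)
  then have "x = a *\<^sub>R n + b *\<^sub>R u" by (simp add: algebra_simps)
  then show ?thesis by blast
qed

lemma lor_frame:
  assumes "pencil_frame n u"
  shows "lor (a *\<^sub>R n + b *\<^sub>R u) (a *\<^sub>R n + b *\<^sub>R u) = b * b"
  using assms by (simp add: pencil_frame_def lor_linear lor_commute)

lemma straight_line_if_ext_line:
  assumes "is_line (ext_line L)" shows "straight_line L"
proof -
  obtain L' where "straight_line L'" "ext_line L = ext_line L'" using assms by (auto simp: is_line_def)
  moreover from this have "L = L'" by (auto simp: ext_line_def)
  ultimately show ?thesis by simp
qed

lemma zeros_line: "zeros (c, 0, k) = ext_line {z. c \<bullet> z = k}"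
proof (rule set_eqI)
  show "P \<in> zeros (c, 0, k) \<longleftrightarrow> P \<in> ext_line {z. c \<bullet> z = k}" for P
    by (cases P) (auto simp: ext_line_def zeros_def lor_def pt_def)
qed

lemma line_vector:
  assumes "represents v C" "is_line C"
  obtains c k where "v = (c, 0, k)" "c \<bullet> c = 1"
proof -
  obtain c a k where v: "v = (c, a, k)" by (cases v)
  have "None \<in> zeros v" using assms by (auto simp: is_line_def ext_line_def represents_def)
  then have "a = 0" by (simp add: zeros_def v lor_def pt_def)
  moreover have "lor v v = 1" using represents_unit assms by blast
  ultimately show ?thesis using that v by (simp add: lor_def)
qed

text \<open>Two unit vectors of the pencil satisfy \<open>w = s v + e n\<close> with a sign
  \<open>s\<close> and \<open>e \<noteq> 0\<close>, so a common zero is orthogonal to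
  \<open>n\<close> and equals \<open>P\<close>. Two lines need parallelism instead, as their
  tangency is not defined by intersection.\<close>

lemma pencil_tangent_at:
  assumes fr: "pencil_frame n u" and n: "n = t *\<^sub>R pt P"
    and v: "represents v C" "v \<in> span {n, u}" and w: "represents w D" "w \<in> span {n, u}"
    and "C \<noteq> D"
  shows "tangent_at P C D"
proof -
  have t: "t \<noteq> 0" using fr n by (auto simp: pencil_frame_def)
  have Z: "C = zeros v" "D = zeros w" using v w by (simp_all add: represents_def)
  obtain a b where ab: "v = a *\<^sub>R n + b *\<^sub>R u" using span_frame_E v(2) by blast
  obtain a' b' where ab': "w = a' *\<^sub>R n + b' *\<^sub>R u" using span_frame_E w(2) by blast
  have P_on: "lor x (pt P) = 0" if x: "x \<in> span {n, u}" for x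
  proof -
    obtain a b where "x = a *\<^sub>R n + b *\<^sub>R u" using span_frame_E[OF x] by blast
    then show ?thesis using fr n t by (auto simp: pencil_frame_def lor_linear lor_commute)
  qed
  then have P: "P \<in> C" "P \<in> D" using v w by (simp_all add: Z zeros_def)
  have point: "X = {P}" if "represents x X" "x \<in> span {n, u}" "is_point X" for x X
  proof -
    have "P \<in> X" using P_on[OF that(2)] that(1) by (simp add: represents_def zeros_def)
    then show ?thesis using that(3) by (auto simp: is_point_def)
  qed
  have kinds: "is_point C \<or> is_circle C \<or> is_line C" "is_point D \<or> is_circle D \<or> is_line D"
    using v(1) w(1) by (auto simp: represents_def)
  consider "is_point C" "is_point D" | "is_point C" "is_circle D \<or> is_line D"
    | "is_circle C \<or> is_line C" "is_point D"
    | "is_circle C \<or> is_line C" "is_circle D \<or> is_line D" using kinds by blast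
  then show ?thesis
  proof cases
    case 1
    then show ?thesis using point v w \<open>C \<noteq> D\<close> by blast
  next
    case 2
    then show ?thesis using point[OF v] P tangent_at.point_left by blast
  next
    case 3
    then show ?thesis using point[OF w] P tangent_at.point_right by blast
  next
    case 4
    have "b * b = 1" "b' * b' = 1"
      using represents_unit[OF v(1)] represents_unit[OF w(1)] 4 lor_frame[OF fr] ab ab' by auto
    then have b: "b = 1 \<or> b = -1" "b' = 1 \<or> b' = -1"
      by (metis power2_eq_1_iff power2_eq_square)+
    define s where "s = b * b'"
    have ss: "s = 1 \<or> s = -1" and "b' = s * b" using b by (auto simp: s_def)
    then have wv: "w = s *\<^sub>R v + (a' - s * a) *\<^sub>R n" by (simp add: ab ab' algebra_simps)
    have ne: "a' - s * a \<noteq> 0"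
      using represents_distinct[OF w(1) v(1), of s] \<open>C \<noteq> D\<close> wv by auto
    have int: "C \<inter> D = {P}"
    proof (intro subset_antisym subsetI)
      fix Q assume "Q \<in> C \<inter> D"
      then have "lor v (pt Q) = 0" "lor w (pt Q) = 0" by (simp_all add: Z zeros_def)
      then have "lor n (pt Q) = 0" using ne by (simp add: wv lor_linear)
      then show "Q \<in> {P}" using n t by (simp add: lor_linear lor_pt_eq_0_iff)
    qed (use P in auto)
    show ?thesis
    proof (cases "is_line C \<and> is_line D")
      case True
      obtain c k where ck: "v = (c, 0, k)" "c \<bullet> c = 1" using line_vector v(1) True by blast
      obtain c' k' where ck': "w = (c', 0, k')" using line_vector w(1) True by blast
      have C: "C = ext_line {z. c \<bullet> z = k}" using Z ck zeros_line by simp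
      then have "None \<in> C" by (simp add: ext_line_def)
      moreover have "None \<in> D" using Z ck' zeros_line by (simp add: ext_line_def)
      ultimately have "None \<in> {P}" unfolding int[symmetric] by simp
      then have "P = None" by simp
      \<comment> \<open>With \<open>P\<close> at infinity \<open>n\<close> is a multiple of
        \<open>(0, 0, 1)\<close>, so the two normals agree up to \<open>s\<close>.\<close>
      then have "c' = s *\<^sub>R c" using wv ck ck' n by (simp add: pt_def)
      moreover have "s * y = k' \<longleftrightarrow> y = s * k'" for y using ss by auto
      ultimately have D: "D = ext_line {z. c \<bullet> z = s * k'}" using Z ck' zeros_line by simp
      have "tangent_at None C D" unfolding C D
      proof (rule tangent_at.parallel_lines)
        show "straight_line {z. c \<bullet> z = k}" "straight_line {z. c \<bullet> z = s * k'}"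
          using True C D straight_line_if_ext_line by auto
        show "{z. c \<bullet> z = k} \<noteq> {z. c \<bullet> z = s * k'}" using \<open>C \<noteq> D\<close> C D by auto
      qed (rule affine_parallel_same_normal[OF ck(2)])
      then show ?thesis using \<open>P = None\<close> by simp
    next
      case False
      then show ?thesis using 4 int tangent_at.circle_circle tangent_at.circle_line tangent_at.line_circle
        by blast
    qed
  qed
qed

text \<open>Up to sign, \<open>w j\<close> is \<open>u + c j n\<close> with distinct
  \<open>c j\<close>. Tangency prescribes the square, 0 or 1, of an affine function at these three
  arguments; two of its values agree, so its slope \<open>lor v n\<close> vanishes.\<close>

lemma tangent_to_pencil_imp_in_pencil:
  assumes fr: "pencil_frame n u"
    and w: "\<And>j. j < 3 \<Longrightarrow> w j \<in> span {n, u}" "\<And>j. j < 3 \<Longrightarrow> lor (w j) (w j) = 1"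
    and w_distinct: "\<And>i j t. i < 3 \<Longrightarrow> j < 3 \<Longrightarrow> i \<noteq> j \<Longrightarrow> w i \<noteq> t *\<^sub>R (w j :: lvec)"
    and v: "lor v v = 1 \<or> lor v v = 0" "\<And>j. j < (3::nat) \<Longrightarrow> (lor v (w j))\<^sup>2 = lor v v"
  shows "v \<in> span {n, u}"
proof -
  have "\<exists>a b. w j = a *\<^sub>R n + b *\<^sub>R u" if "j < 3" for j
    using span_frame_E[OF w(1)[OF that]] .
  then obtain a b where ab: "\<And>j. j < 3 \<Longrightarrow> w j = a j *\<^sub>R n + b j *\<^sub>R u" by metis
  have b: "b j = 1 \<or> b j = -1" if "j < 3" for j
    using w(2)[OF that] lor_frame[OF fr] ab[OF that] by (metis power2_eq_1_iff power2_eq_square)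
  define c where "c j = b j * a j" for j
  have w_c: "w j = b j *\<^sub>R (c j *\<^sub>R n + u)" if "j < 3" for j
    using b[OF that] ab[OF that] by (auto simp: c_def)
  have c_ne: "c i \<noteq> c j" if ij: "i < 3" "j < 3" "i \<noteq> j" for i j
  proof
    assume "c i = c j"
    then have "w i = (b i * b j) *\<^sub>R w j" using w_c[OF ij(1)] w_c[OF ij(2)] b[OF ij(2)] by auto
    then show False using w_distinct[OF ij] by blast
  qed
  define X Y where "X = lor v n" and "Y = lor v u"
  have sq: "(c j * X + Y)\<^sup>2 = lor v v" if "j < 3" for j
  proof -
    have "lor v (w j) = b j * (c j * X + Y)" by (simp add: w_c[OF that] lor_linear X_def Y_def)
    then show ?thesis using v(2)[OF that] b[OF that] by (auto simp: power_mult_distrib)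
  qed
  define p where "p j = c j * X + Y" for j
  have X0: "X = 0" if "i < 3" "j < 3" "i \<noteq> j" "p i = p j" for i j
    using c_ne that by (auto simp: p_def)
  have "p 0 = p 1 \<or> p 0 = p 2 \<or> p 1 = p 2"
  proof (cases "lor v v = 0")
    case True
    then show ?thesis using sq[of 0] sq[of 1] by (simp add: p_def)
  next
    case False
    then have "p j = 1 \<or> p j = -1" if "j < 3" for j
      using sq[OF that] v(1) by (simp add: p_def power2_eq_1_iff)
    from this[of 0] this[of 1] this[of 2] show ?thesis by auto
  qed
  then have "X = 0" using X0[of 0 1] X0[of 0 2] X0[of 1 2] by auto
  then have X: "X = 0" .
  then have Y: "Y\<^sup>2 = lor v v" using sq[of 0] by simp
  show ?thesis
  proof (cases "lor v v = 0")
    case True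
    then obtain t where "v = t *\<^sub>R n"
      using null_orthogonal_imp_collinear[of v n] fr X by (auto simp: X_def pencil_frame_def)
    then show ?thesis by (simp add: span_base span_scale)
  next
    case False
    then show ?thesis using orthogonal_unit_in_pencil[OF fr, of v] X Y v(1) by (simp add: X_def Y_def)
  qed
qed

theorem mainTheorem2:
  fixes F :: "ext_plane set set"
  assumes "card F = 5"
    and "\<And>C. C \<in> F \<Longrightarrow> gen_circle C"
    and "\<not> all_tangent_at_one_point F"
  shows "finite {X. gen_circle X \<and> (\<forall>C\<in>F. tangent X C)} \<and>
         card {X. gen_circle X \<and> (\<forall>C\<in>F. tangent X C)} \<le> 4"
proof (rule ccontr)
  define S where "S = {X. gen_circle X \<and> (\<forall>C\<in>F. tangent X C)}"
  assume "\<not> ?thesis"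
  then have neg: "\<not> (finite S \<and> card S \<le> 4)" by (simp add: S_def)
  \<comment> \<open>An infinite \<open>S\<close> has \<open>card S = 0\<close>, so it is treated
    separately; either way five tangent generalized circles are available.\<close>
  have "\<exists>G. finite G \<and> card G = 5 \<and> G \<subseteq> S"
  proof (cases "finite S")
    case True
    then have "5 \<le> card S" using neg by simp
    then obtain G where "G \<subseteq> S" "card G = 5" "finite G" by (rule obtain_subset_with_card_n)
    then show ?thesis by blast
  next
    case False
    then show ?thesis by (rule infinite_arbitrarily_large)
  qed
  then obtain G where G: "G \<subseteq> S" "finite G" "card G = 5" by blast
  have "finite F" using assms(1) by (metis card.infinite zero_neq_numeral)
  obtain f :: "nat \<Rightarrow> ext_plane set" where "bij_betw f {0..<5} F" using ex_bij_betw_nat_finite[OF \<open>finite F\<close>] assms(1) by metis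
  then have f: "inj_on f {..<5}" "f ` {..<5} = F" by (simp_all add: bij_betw_def atLeast0LessThan)
  obtain g :: "nat \<Rightarrow> ext_plane set" where "bij_betw g {0..<5} G" using ex_bij_betw_nat_finite[OF G(2)] G(3) by metis
  then have g: "inj_on g {..<5}" "g ` {..<5} = G" by (simp_all add: bij_betw_def atLeast0LessThan)
  have "\<exists>x. represents x (f i)" if "i < 5" for i
    using f(2) that assms(2) gen_circle_represents by blast
  then obtain v where v: "\<And>i. i < 5 \<Longrightarrow> represents (v i) (f i)" by metis
  have "\<exists>x. represents x (g j)" if "j < 5" for j
    using g(2) that G(1) gen_circle_represents by (auto simp: S_def)
  then obtain w where w: "\<And>j. j < 5 \<Longrightarrow> represents (w j) (g j)" by metis
  have tan: "(lor (v i) (w j))\<^sup>2 = lor (v i) (v i) * lor (w j) (w j)"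
      "lor (v i) (v i) = 1 \<or> lor (w j) (w j) = 1" if "i < 5" "j < 5" for i j
  proof -
    have "tangent (g j) (f i)" using f(2) g(2) G(1) that by (auto simp: S_def)
    from tangent_imp_lor[OF w[OF that(2)] v[OF that(1)] this]
    show "(lor (v i) (w j))\<^sup>2 = lor (v i) (v i) * lor (w j) (w j)"
      "lor (v i) (v i) = 1 \<or> lor (w j) (w j) = 1" by (auto simp: lor_commute)
  qed
  have v_kind: "lor (v i) (v i) = 1 \<or> lor (v i) (v i) = 0" "v i \<noteq> 0" if "i < 5" for i
    using v[OF that] by (auto simp: represents_def)
  have w_kind: "lor (w i) (w i) = 1 \<or> lor (w i) (w i) = 0" "w i \<noteq> 0" if "i < 5" for i
    using w[OF that] by (auto simp: represents_def)
  have v_ne: "v i \<noteq> t *\<^sub>R v j" if "i < 5" "j < 5" "i \<noteq> j" for i j t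
  proof -
    have "f i \<noteq> f j" using f(1) that by (simp add: inj_on_eq_iff)
    then show ?thesis by (rule represents_distinct[OF v[OF that(1)] v[OF that(2)]])
  qed
  have w_ne: "w i \<noteq> t *\<^sub>R w j" if "i < 5" "j < 5" "i \<noteq> j" for i j t
  proof -
    have "g i \<noteq> g j" using g(1) that by (simp add: inj_on_eq_iff)
    then show ?thesis by (rule represents_distinct[OF w[OF that(1)] w[OF that(2)]])
  qed
  have "\<exists>n u. pencil_frame n u \<and> (\<forall>i<5. v i \<in> span {n, u})"
  proof (cases "\<forall>i<5. lor (v i) (v i) = 1")
    case True
    have "tangent_families v w"
    proof
      show "v i \<noteq> v j \<and> v i \<noteq> - v j" if "i < 5" "j < 5" "i \<noteq> j" for i j
        using v_ne[OF that, of 1] v_ne[OF that, of "-1"] by simp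
    qed (use True w_kind w_ne tan in auto)
    then show ?thesis by (rule tangent_families.pencil)
  next
    case False
    \<comment> \<open>A point among the \<open>v\<close>s is tangent to every \<open>w\<close>, so
      no \<open>w\<close> is a point. The families swap roles, and three of the \<open>w\<close>s
      bring the pencil back to the \<open>v\<close>s.\<close>
    then have w_unit: "lor (w j) (w j) = 1" if "j < 5" for j using tan(2) that by blast
    have "tangent_families w v"
    proof
      show "w i \<noteq> w j \<and> w i \<noteq> - w j" if "i < 5" "j < 5" "i \<noteq> j" for i j
        using w_ne[OF that, of 1] w_ne[OF that, of "-1"] by simp
      show "(lor (w i) (v j))\<^sup>2 = lor (v j) (v j)" if "i < 5" "j < 5" for i j
        using tan(1)[OF that(2,1)] w_unit[OF that(1)] by (simp add: lor_commute)
    qed (use w_unit v_kind v_ne in auto)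
    then obtain n u where nu: "pencil_frame n u" "\<And>j. j < 5 \<Longrightarrow> w j \<in> span {n, u}"
      using tangent_families.pencil by blast
    have "v i \<in> span {n, u}" if i: "i < 5" for i
    proof (rule tangent_to_pencil_imp_in_pencil[OF nu(1), of w])
      show "lor (v i) (v i) = 1 \<or> lor (v i) (v i) = 0" using v_kind i by blast
      show "(lor (v i) (w j))\<^sup>2 = lor (v i) (v i)" if "j < 3" for j
        using tan(1)[OF i, of j] w_unit[of j] that by simp
    qed (use nu(2) w_unit w_ne in simp_all)
    then show ?thesis using nu(1) by blast
  qed
  then obtain n u where nu: "pencil_frame n u" "\<And>i. i < 5 \<Longrightarrow> v i \<in> span {n, u}" by blast
  then obtain P t where n: "n = t *\<^sub>R pt P"
    using null_vector_is_pt by (metis pencil_frame_def)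
  have "pairwise (tangent_at P) F"
  proof (rule pairwiseI)
    fix C D assume "C \<in> F" "D \<in> F" "C \<noteq> D"
    then obtain i j where "i < 5" "C = f i" "j < 5" "D = f j" using f(2) by blast
    then show "tangent_at P C D"
      using pencil_tangent_at[OF nu(1) n] v nu(2) \<open>C \<noteq> D\<close> by blast
  qed
  then show False using assms(3) by (auto simp: all_tangent_at_one_point_def)
qed

end
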